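(* Let $M\in M_n(\mathbb R)$ be LCP-generic and such that $1\notin\mathrm{Spec}^a_L(M)$. Then the degree of $G_M$ is well-defined and it satisfies $$\deg G_M=\operatorname{sign}(\det(M+\mathbb I))-\sum_{\substack{(\lambda,S,v)\text{ LCP-aligned trio of }M\\ \lambda>1}}\operatorname{sign}\Bigl(\chi'_{M+\mathbb I,\,(M-\mathbb I)S}(\lambda)\Bigr),$$ where $\chi_{U,V}(T):=\det(TU-V)$ is the generalized characteristic polynomial of $(U,V)\in M_n(\mathbb R)^2$ and $\chi'_{U,V}$ is its derivative with respect to $T$.
   Context: $M_n(\mathbb R)$ is the space of real $n\times n$ matrices, $\mathbb I$ is the identity matrix, and $|\cdot|$ denotes the componentwise absolute value. $\mathcal S_n$ is the set of diagonal $n\times n$ matrices with all diagonal entries in $\{-1,+1\}$. For $M\in M_n(\mathbb R)$ let $G_M:\mathbb R^n\to\mathbb R^n$, $G_M(z)=\tfrac12(M+\mathbb I)z-\tfrac12(M-\mathbb I)|z|$. An LCP-aligned trio of $M$ is a triple $(\lambda,S,v)$ with $\lambda\ge0$ real, $S\in\mathcal S_n$, $v\in\mathbb R^n_{\ge0}$, $\|v\|_2=1$, and $(M-\mathbb I)v=\lambda(M+\mathbb I)Sv$. Then $\lambda$ is an LCP-aligned value of $M$, and $\mathrm{Spec}^a_L(M)$ is the set of LCP-aligned values of $M$. A matrix $A\in M_n(\mathbb R)$ is generic if for every triple $(\lambda,S,v)$ with $\lambda\ge 0$, $S\in\mathcal S_n$, $v\in\mathbb R^n_{\ge 0}$, $\|v\|_2=1$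 and $SAv=\lambda v$, $\lambda$ is a simple eigenvalue of $SA$ and $v$ is strictly positive. $M$ is LCP-generic if $M+\mathbb I$ is invertible and $(M+\mathbb I)^{-1}(M-\mathbb I)$ is generic. If $G_M(z)=0$ only for $z=0$ ($G_M$ nondegenerate), $\deg G_M$ is the topological degree of $\bar G_M:\mathbb S^{n-1}\to\mathbb S^{n-1}$, $x\mapsto G_M(x)/\|G_M(x)\|_2$ (defined via reduced homology if $n=1$). "The degree is well-defined" means that $G_M$ is nondegenerate. *)

theory Defs
  imports
    "HOL-Homology.Homology"
    "Jordan_Normal_Form.Char_Poly"
    "Jordan_Normal_Form.Gauss_Jordan_Elimination"
begin

definition sign_mats :: "nat \<Rightarrow> real mat set" where
  "sign_mats n = {S \<in> carrier_mat n n. diagonal_mat S \<and> (\<forall>i<n. S $$ (i, i) \<in> {-1, 1})}"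

definition l2_norm_vec :: "real vec \<Rightarrow> real" where
  "l2_norm_vec v = sqrt (v \<bullet> v)"

text \<open>The order on \<open>real vec\<close> is componentwise and forces equal dimensions.\<close>

definition nonneg_unit_vecs :: "nat \<Rightarrow> real vec set" where
  "nonneg_unit_vecs n = {v \<in> carrier_vec n. 0\<^sub>v n \<le> v \<and> l2_norm_vec v = 1}"

text \<open>Simplicity is meant algebraically: a simple eigenvalue is a simple root of the
  characteristic polynomial.\<close>

definition simple_eigenvalue :: "real mat \<Rightarrow> real \<Rightarrow> bool" where
  "simple_eigenvalue A l \<longleftrightarrow> eigenvalue A l \<and> Polynomial.order l (char_poly A) = 1"

definition generic_mat :: "nat \<Rightarrow> real mat \<Rightarrow> bool" where
  "generic_mat n A \<longleftrightarrow>
     (\<forall>l S v. l \<ge> 0 \<and> S \<in> sign_mats n \<and> v \<in> nonneg_unit_vecs n \<and>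
        (S * A) *\<^sub>v v = l \<cdot>\<^sub>v v \<longrightarrow>
        simple_eigenvalue (S * A) l \<and> (\<forall>i<n. v $ i > 0))"

definition lcp_generic :: "nat \<Rightarrow> real mat \<Rightarrow> bool" where
  "lcp_generic n M \<longleftrightarrow>
     invertible_mat (M + 1\<^sub>m n) \<and>
     generic_mat n (the (mat_inverse (M + 1\<^sub>m n)) * (M - 1\<^sub>m n))"

definition lcp_aligned_trios :: "nat \<Rightarrow> real mat \<Rightarrow> (real \<times> real mat \<times> real vec) set" where
  "lcp_aligned_trios n M =
     {(l, S, v). l \<ge> 0 \<and> S \<in> sign_mats n \<and> v \<in> nonneg_unit_vecs n \<and>
        (M - 1\<^sub>m n) *\<^sub>v v = l \<cdot>\<^sub>v ((M + 1\<^sub>m n) *\<^sub>v (S *\<^sub>v v))}"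

definition lcp_aligned_spec :: "nat \<Rightarrow> real mat \<Rightarrow> real set" where
  "lcp_aligned_spec n M = {l. \<exists>S v. (l, S, v) \<in> lcp_aligned_trios n M}"

definition lcp_map :: "nat \<Rightarrow> real mat \<Rightarrow> real vec \<Rightarrow> real vec" where
  "lcp_map n M z =
     (1/2) \<cdot>\<^sub>v ((M + 1\<^sub>m n) *\<^sub>v z) - (1/2) \<cdot>\<^sub>v ((M - 1\<^sub>m n) *\<^sub>v map_vec abs z)"

definition nondegenerate_map :: "nat \<Rightarrow> (real vec \<Rightarrow> real vec) \<Rightarrow> bool" where
  "nondegenerate_map n G \<longleftrightarrow> (\<forall>z \<in> carrier_vec n. G z = 0\<^sub>v n \<longrightarrow> z = 0\<^sub>v n)"

text \<open>\<^const>\<open>nsphere\<close> realises the sphere as the unit vectors among the functions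
  \<open>nat \<Rightarrow> real\<close> supported on the first coordinates; such functions are identified with the
  vectors of dimension \<open>n\<close>.\<close>

definition normalized_sphere_map ::
    "nat \<Rightarrow> (real vec \<Rightarrow> real vec) \<Rightarrow> (nat \<Rightarrow> real) \<Rightarrow> nat \<Rightarrow> real" where
  "normalized_sphere_map n G x =
     (let y = G (Matrix.vec n x) in (\<lambda>i. if i < n then y $ i / l2_norm_vec y else 0))"

text \<open>\<^const>\<open>Brouwer_degree2\<close> is the degree of a self-map of \<open>nsphere (n - 1)\<close> in reduced homology,
  which also covers \<open>n = 1\<close>. The value is meaningful only for \<open>n \<ge> 1\<close> and a continuous
  map \<open>G\<close> without zeros on the sphere.\<close>

definition map_degree :: "nat \<Rightarrow> (real vec \<Rightarrow> real vec) \<Rightarrow> int" where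
  "map_degree n G = Brouwer_degree2 (n - 1) (normalized_sphere_map n G)"

text \<open>The polynomial \<open>det (T U - V)\<close> in the indeterminate \<open>T\<close>.\<close>

definition gen_char_poly :: "real mat \<Rightarrow> real mat \<Rightarrow> real poly" where
  "gen_char_poly U V =
     Determinant.det ([:0, 1:] \<cdot>\<^sub>m map_mat (\<lambda>a. [:a:]) U - map_mat (\<lambda>a. [:a:]) V)"

lemma poly_gen_char_poly:
  assumes "U \<in> carrier_mat n n" "V \<in> carrier_mat n n"
  shows "poly (gen_char_poly U V) t = Determinant.det (t \<cdot>\<^sub>m U - V)"
  unfolding gen_char_poly_def using assms
  by (intro poly_det_cong[where n = n]) auto

end

theory Submission
  imports Defs
begin

text \<open>Put \<open>A = (M + I)\<^sup>-\<^sup>1 (M - I)\<close>. Then \<open>G\<^sub>M\<close> is the linear map \<open>(M + I) / 2\<close> after \<open>x - A |x|\<close>,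
  and the pencil \<open>x - s A |x|\<close>, \<open>0 \<le> s \<le> 1\<close>, joins the latter to the identity. On the unit sphere
  the pencil vanishes exactly at the points \<open>S v\<close> of the trios \<open>(\<lambda>, S, v)\<close> with \<open>\<lambda> > 1\<close>, at time
  \<open>s = 1 / \<lambda>\<close>; genericity makes these finitely many and puts each of them inside an orthant, where
  the pencil is the linear map \<open>I - s A S\<close>. Letting \<open>s\<close> depend on \<open>x\<close>, one crossing is passed
  at a time, and by additivity of the degree the jump only depends on the pencil near \<open>S v\<close>.
  It can therefore be computed from the linear pencil on the whole sphere, which by symmetry jumps
  equally at \<open>S v\<close> and \<open>- S v\<close>, hence at each by half the jump of the sign of \<open>det (I - s A S)\<close>.\<close>

subsection \<open>Degrees of vector fields on the sphere\<close>

text \<open>Several crossings may share one time \<open>1 / \<lambda>\<close>, so moving a constant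
  time through it would mix their contributions; a time that varies over the sphere separates them.
  The two halves of genericity enter differently. Positivity of \<open>v\<close> places the crossing
  inside an orthant and makes the eigenspace a line (\<open>generic_mat_eigenspace\<close>), so that
  the linear pencil crosses only at \<open>S v\<close> and \<open>- S v\<close>. Algebraic
  simplicity isolates the crossing in time and makes the characteristic polynomial of
  \<open>A * S\<close> change sign at \<open>\<lambda>\<close>. As \<open>det (I - s A S)\<close> is
  \<open>s ^ n\<close> times that polynomial at \<open>1 / s\<close>, increasing \<open>s\<close>
  passes \<open>\<lambda>\<close> downwards: the sign of the determinant changes by minus twice the
  sign of the derivative, and half of this is the summand of the formula. The value 1 is excluded
  because it would be a crossing at the end \<open>s = 1\<close>, that is, a nontrivial zero of the
  map. Additivity is proved on singular chains and so covers every dimension, including the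
  two-point sphere of \<open>n = 1\<close>.\<close>

lemma chain_map_additive_cover:
  assumes c: "singular_chain p X c"
    and small: "\<And>\<sigma>. \<sigma> \<in> Poly_Mapping.keys c \<Longrightarrow>
                  \<sigma> \<in> standard_simplex p \<rightarrow> U \<or> \<sigma> \<in> standard_simplex p \<rightarrow> V"
    and U: "\<And>x. x \<in> topspace X \<inter> U \<Longrightarrow> f x = f' x \<and> g x = g' x"
    and V: "\<And>x. x \<in> topspace X \<inter> V \<Longrightarrow> f x = g x \<and> f' x = g' x"
  shows "chain_map p f c + chain_map p g' c = chain_map p g c + chain_map p f' c"
proof -
  let ?P = "\<lambda>\<sigma>. singular_simplex p X \<sigma> \<and>
              (\<sigma> \<in> standard_simplex p \<rightarrow> U \<or> \<sigma> \<in> standard_simplex p \<rightarrow> V)"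
  have "Poly_Mapping.keys c \<subseteq> Collect ?P"
    using c small unfolding singular_chain_def by blast
  then show ?thesis
  proof (induction c rule: frag_induction)
    case (one \<sigma>)
    then have im: "\<sigma> t \<in> topspace X" if "t \<in> standard_simplex p" for t
      using that by (auto simp: singular_simplex_def continuous_map_def Pi_iff)
    from one consider "\<sigma> \<in> standard_simplex p \<rightarrow> U" | "\<sigma> \<in> standard_simplex p \<rightarrow> V" by blast
    then show ?case
    proof cases
      case 1
      then have "simplex_map p f \<sigma> = simplex_map p f' \<sigma>" "simplex_map p g \<sigma> = simplex_map p g' \<sigma>"
        using im U by (auto simp: simplex_map_def Pi_iff intro!: restrict_ext)
      then show ?thesis by simp
    next
      case 2
      then have "simplex_map p f \<sigma> = simplex_map p g \<sigma>" "simplex_map p f' \<sigma> = simplex_map p g' \<sigma>"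
        using im V by (auto simp: simplex_map_def Pi_iff intro!: restrict_ext)
      then show ?thesis by simp
    qed
  next
    case (diff a b)
    have "chain_map p f (a - b) + chain_map p g' (a - b)
        = (chain_map p f a + chain_map p g' a) - (chain_map p f b + chain_map p g' b)"
      by (simp add: chain_map_diff)
    also have "\<dots> = (chain_map p g a + chain_map p f' a) - (chain_map p g b + chain_map p f' b)"
      by (simp only: diff)
    finally show ?case by (simp add: chain_map_diff)
  qed auto
qed

text \<open>Homology groups are multiplicative groups of cosets, while chains are added; this lets
  an identity between sums of chains be read as one between products of classes.\<close>

lemma mult_homologous_rel_set:
  assumes "singular_relcycle p X S a" "singular_relcycle p X S b"
  shows "homologous_rel_set p X S a \<otimes>\<^bsub>relative_homology_group (int p) X S\<^esub> homologous_rel_set p X S b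
       = homologous_rel_set p X S (a + b)"
proof -
  have rc: "r_coset (relcycle_group p X S) (singular_relboundary_set p X S) c = homologous_rel_set p X S c" for c
    by (simp add: right_coset_singular_relboundary)
  interpret N: normal "singular_relboundary_set p X S" "relcycle_group p X S"
    by (rule normal_subgroup_singular_relboundary_relcycle)
  have "r_coset (relcycle_group p X S) (singular_relboundary_set p X S) a
          <#>\<^bsub>relcycle_group p X S\<^esub> r_coset (relcycle_group p X S) (singular_relboundary_set p X S) b
      = r_coset (relcycle_group p X S) (singular_relboundary_set p X S) (a + b)"
    using N.rcos_sum[of a b] assms by simp
  then show ?thesis
    by (simp add: rc nontrivial_relative_homology_group FactGroup_def)
qed

text \<open>Each simplex of a sufficiently fine fundamental cycle lies in \<open>U\<close> or in \<open>V\<close>, where the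
  four pushed-forward chains cancel in pairs.\<close>

lemma Brouwer_degree2_additive_cover:
  assumes cont: "continuous_map (nsphere p) (nsphere p) f" "continuous_map (nsphere p) (nsphere p) g"
      "continuous_map (nsphere p) (nsphere p) f'" "continuous_map (nsphere p) (nsphere p) g'"
    and op: "openin (nsphere p) U" "openin (nsphere p) V" "topspace (nsphere p) \<subseteq> U \<union> V"
    and U: "\<And>x. x \<in> U \<Longrightarrow> f x = f' x \<and> g x = g' x"
    and V: "\<And>x. x \<in> V \<Longrightarrow> f x = g x \<and> f' x = g' x"
  shows "Brouwer_degree2 p f - Brouwer_degree2 p g = Brouwer_degree2 p f' - Brouwer_degree2 p g'"
proof -
  let ?X = "nsphere p"
  let ?G = "reduced_homology_group (int p) ?X"
  let ?H = "homology_group (int p) ?X"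
  let ?h = "\<lambda>f. hom_induced (int p) ?X {} ?X {} f"
  interpret G: group ?G by simp
  obtain a where a: "a \<in> carrier ?G" and aeq: "subgroup_generated ?G {a} = ?G"
    using cyclic_reduced_homology_group_nsphere [of p p] by (auto simp: cyclic_group_def)
  \<comment> \<open>Order 0 encodes infinite order; it allows exponents of the generator to be
    compared at the end.\<close>
  have ord: "G.ord a = 0"
    by (simp add: a aeq iso_finite [OF reduced_homology_group_nsphere(1)]
        flip: G.infinite_cyclic_subgroup_order)
  have "a \<in> carrier ?H" using a carrier_reduced_homology_group_subset by blast
  then obtain c where c: "singular_relcycle p ?X {} c" "a = homologous_rel_set p ?X {} c"
    by (auto simp: carrier_relative_homology_group)
  \<comment> \<open>Iterated subdivision replaces \<open>c\<close> by a homologous cycle subordinate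
    to the cover.\<close>
  obtain c' where c': "singular_relcycle p ?X {} c'" "homologous_rel p ?X {} c c'"
    and small: "\<And>\<sigma>. \<sigma> \<in> Poly_Mapping.keys c' \<Longrightarrow> \<exists>W \<in> {U,V}. \<sigma> \<in> standard_simplex p \<rightarrow> W"
  proof (rule small_homologous_rel_relcycle_exists [of "{U,V}" ?X p "{}" c])
    show "topspace ?X \<subseteq> \<Union>{U, V}" using op by simp
  qed (use op c in auto)
  have ac': "a = homologous_rel_set p ?X {} c'"
    using c c' by (simp add: homologous_rel_set_eq)
  have hc: "?h k a = homologous_rel_set p ?X {} (chain_map p k c')"
    if "continuous_map ?X ?X k" for k
    unfolding ac' using that c'(1) by (intro hom_induced_chain_map) auto
  have rel: "singular_relcycle p ?X {} (chain_map p k c')" if "continuous_map ?X ?X k" for k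
    using singular_relcycle_chain_map [OF c'(1) that] by auto
  have mult: "?h k a \<otimes>\<^bsub>?H\<^esub> ?h l a = homologous_rel_set p ?X {} (chain_map p k c' + chain_map p l c')"
    if "continuous_map ?X ?X k" "continuous_map ?X ?X l" for k l
    using that by (simp add: hc mult_homologous_rel_set rel)
  have "chain_map p f c' + chain_map p g' c' = chain_map p g c' + chain_map p f' c'"
  proof (rule chain_map_additive_cover)
    show "singular_chain p ?X c'" using c'(1) by (simp add: singular_relcycle_def)
    show "\<And>\<sigma>. \<sigma> \<in> Poly_Mapping.keys c' \<Longrightarrow>
       \<sigma> \<in> standard_simplex p \<rightarrow> U \<or> \<sigma> \<in> standard_simplex p \<rightarrow> V"
      using small by blast
  qed (use U V in auto)
  then have "?h f a \<otimes>\<^bsub>?H\<^esub> ?h g' a = ?h g a \<otimes>\<^bsub>?H\<^esub> ?h f' a"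
    by (simp add: mult cont)
  then have "?h f a \<otimes>\<^bsub>?G\<^esub> ?h g' a = ?h g a \<otimes>\<^bsub>?G\<^esub> ?h f' a"
    by (simp add: reduced_homology_group_def)
  then have "a [^]\<^bsub>?G\<^esub> (Brouwer_degree2 p f + Brouwer_degree2 p g')
      = a [^]\<^bsub>?G\<^esub> (Brouwer_degree2 p g + Brouwer_degree2 p f')"
    using a by (simp add: Brouwer_degree2 G.int_pow_mult)
  then show ?thesis
    using a ord by (simp add: G.int_pow_eq)
qed

section \<open>Degrees of nowhere vanishing fields\<close>

definition radial :: "nat \<Rightarrow> (nat \<Rightarrow> real) \<Rightarrow> nat \<Rightarrow> real" where
  "radial m y = (\<lambda>i. if i \<le> m then y i / sqrt (\<Sum>j\<le>m. (y j)\<^sup>2) else 0)"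

text \<open>Only coordinates up to \<open>m\<close> are constrained, since \<open>radial\<close>
  discards the others. Fields built from matrices have unspecified values beyond \<open>m\<close>,
  where entries are read out of range.\<close>

definition field_on_sphere :: "nat \<Rightarrow> ((nat \<Rightarrow> real) \<Rightarrow> nat \<Rightarrow> real) \<Rightarrow> bool" where
  "field_on_sphere m F \<longleftrightarrow>
     (\<forall>i\<le>m. continuous_map (nsphere m) euclideanreal (\<lambda>x. F x i)) \<and>
     (\<forall>x\<in>topspace (nsphere m). \<exists>i\<le>m. F x i \<noteq> 0)"

definition field_degree :: "nat \<Rightarrow> ((nat \<Rightarrow> real) \<Rightarrow> nat \<Rightarrow> real) \<Rightarrow> int" where
  "field_degree m F = Brouwer_degree2 m (\<lambda>x. radial m (F x))"

lemma topspace_nsphere: "topspace (nsphere m) = {x. (\<Sum>i\<le>m. (x i)\<^sup>2) = 1 \<and> (\<forall>i>m. x i = 0)}"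
  by (simp add: nsphere)

lemma nsphere_eqI:
  assumes "x \<in> topspace (nsphere m)" "y \<in> topspace (nsphere m)" "\<And>i. i \<le> m \<Longrightarrow> x i = y i"
  shows "x = y"
proof
  fix i show "x i = y i" using assms by (cases "i \<le> m") (auto simp: topspace_nsphere)
qed

lemma sum_squares_pos_iff:
  fixes y :: "nat \<Rightarrow> real"
  shows "0 < (\<Sum>j\<le>m. (y j)\<^sup>2) \<longleftrightarrow> (\<exists>i\<le>m. y i \<noteq> 0)"
proof -
  have "(\<Sum>j\<le>m. (y j)\<^sup>2) = 0 \<longleftrightarrow> (\<forall>j\<le>m. y j = 0)"
    by (subst sum_nonneg_eq_0_iff) auto
  moreover have "0 \<le> (\<Sum>j\<le>m. (y j)\<^sup>2)" by (simp add: sum_nonneg)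
  ultimately show ?thesis by (auto simp: less_le)
qed

lemma continuous_map_radial:
  assumes "\<And>i. i \<le> m \<Longrightarrow> continuous_map X euclideanreal (\<lambda>x. F x i)"
    and "\<And>x. x \<in> topspace X \<Longrightarrow> \<exists>i\<le>m. F x i \<noteq> 0"
  shows "continuous_map X (nsphere m) (\<lambda>x. radial m (F x))"
proof -
  have pos: "0 < (\<Sum>j\<le>m. (F x j)\<^sup>2)" if "x \<in> topspace X" for x
    using assms(2)[OF that] by (simp add: sum_squares_pos_iff)
  have "continuous_map X euclideanreal (\<lambda>x. radial m (F x) i)" for i
  proof (cases "i \<le> m")
    case True
    have "continuous_map X euclideanreal (\<lambda>x. F x i / sqrt (\<Sum>j\<le>m. (F x j)\<^sup>2))"
      using assms(1) True pos
      by (intro continuous_map_real_divide continuous_intros) (auto simp: less_imp_neq[symmetric])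
    then show ?thesis using True by (simp add: radial_def)
  qed (simp add: radial_def)
  moreover have "(\<Sum>i\<le>m. (radial m (F x) i)\<^sup>2) = 1" if "x \<in> topspace X" for x
    using pos[OF that] by (simp add: radial_def power_divide flip: sum_divide_distrib)
  ultimately show ?thesis
    by (simp add: nsphere continuous_map_in_subtopology continuous_map_componentwise_UNIV Pi_iff)
       (simp add: radial_def)
qed

lemma continuous_map_radial_field:
  "field_on_sphere m F \<Longrightarrow> continuous_map (nsphere m) (nsphere m) (\<lambda>x. radial m (F x))"
  by (rule continuous_map_radial) (auto simp: field_on_sphere_def)

lemma radial_on_sphere: "x \<in> topspace (nsphere m) \<Longrightarrow> radial m x = x"
  by (auto simp: topspace_nsphere radial_def)

lemma radial_scale:
  assumes "0 < c" shows "radial m (\<lambda>i. c * y i) = radial m y"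
  using assms by (auto simp: radial_def power_mult_distrib real_sqrt_mult simp flip: sum_distrib_left)

lemma radial_cong: "(\<And>i. i \<le> m \<Longrightarrow> x i = y i) \<Longrightarrow> radial m x = radial m y"
  by (auto simp: radial_def)

lemma field_degree_cong:
  assumes "\<And>x i. \<lbrakk>x \<in> topspace (nsphere m); i \<le> m\<rbrakk> \<Longrightarrow> F x i = G x i"
  shows "field_degree m F = field_degree m G"
  unfolding field_degree_def using assms by (intro Brouwer_degree2_eq radial_cong) auto

lemma field_degree_id: "field_degree m (\<lambda>x. x) = 1"
proof -
  have "field_degree m (\<lambda>x. x) = Brouwer_degree2 m id"
    unfolding field_degree_def by (rule Brouwer_degree2_eq) (simp add: radial_on_sphere)
  then show ?thesis by simp
qed

lemma field_degree_homotopy: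
  fixes H :: "real \<Rightarrow> (nat \<Rightarrow> real) \<Rightarrow> nat \<Rightarrow> real"
  assumes cont: "\<And>i. i \<le> m \<Longrightarrow> continuous_map (prod_topology (top_of_set {0..1}) (nsphere m))
                        euclideanreal (\<lambda>p. H (fst p) (snd p) i)"
    and nz: "\<And>t x. \<lbrakk>0 \<le> t; t \<le> 1; x \<in> topspace (nsphere m)\<rbrakk> \<Longrightarrow> \<exists>i\<le>m. H t x i \<noteq> 0"
  shows "field_degree m (H 0) = field_degree m (H 1)"
proof -
  have "continuous_map (prod_topology (top_of_set {0..1}) (nsphere m)) (nsphere m)
          (\<lambda>p. radial m (H (fst p) (snd p)))" (is ?cont)
    using cont nz by (intro continuous_map_radial) auto
  have "homotopic_with (\<lambda>x. True) (nsphere m) (nsphere m)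
      (\<lambda>x. radial m (H 0 x)) (\<lambda>x. radial m (H 1 x))"
    unfolding homotopic_with_def
    by (intro exI[of _ "\<lambda>p. radial m (H (fst p) (snd p))"] conjI allI ballI)
      (simp_all add: \<open>?cont\<close>)
  then show ?thesis
    unfolding field_degree_def by (rule Brouwer_degree2_homotopic)
qed

text \<open>Normalising between the two maps rescales the argument of \<open>F\<close> by a positive
  factor, which homogeneity pulls out and the outer normalisation removes. The inner
  \<open>radial\<close> also zeroes the coordinates beyond \<open>m\<close>; hence the assumption
  \<open>dep\<close>.\<close>

lemma field_degree_compose:
  assumes F: "field_on_sphere m F" and G: "field_on_sphere m G"
    and hom: "\<And>c y i. \<lbrakk>0 < c; i \<le> m\<rbrakk> \<Longrightarrow> F (\<lambda>j. c * y j) i = c * F y i"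
    and dep: "\<And>y z i. \<lbrakk>\<And>j. j \<le> m \<Longrightarrow> y j = z j; i \<le> m\<rbrakk> \<Longrightarrow> F y i = F z i"
  shows "field_degree m (\<lambda>x. F (G x)) = field_degree m F * field_degree m G"
proof -
  have "radial m (F (G x)) = radial m (F (radial m (G x)))" if "x \<in> topspace (nsphere m)" for x
  proof -
    define r where "r = sqrt (\<Sum>j\<le>m. (G x j)\<^sup>2)"
    have r: "0 < r"
      using G that unfolding r_def by (simp add: field_on_sphere_def sum_squares_pos_iff)
    have "F (radial m (G x)) i = inverse r * F (G x) i" if "i \<le> m" for i
    proof -
      have "F (radial m (G x)) i = F (\<lambda>j. inverse r * G x j) i"
        using that by (intro dep) (auto simp: radial_def r_def divide_inverse mult.commute)
      then show ?thesis using hom r that by simp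
    qed
    then have "radial m (F (radial m (G x))) = radial m (\<lambda>i. inverse r * F (G x) i)"
      by (intro radial_cong) auto
    then show ?thesis using r by (simp add: radial_scale)
  qed
  then have "field_degree m (\<lambda>x. F (G x))
      = Brouwer_degree2 m ((\<lambda>x. radial m (F x)) \<circ> (\<lambda>x. radial m (G x)))"
    unfolding field_degree_def by (intro Brouwer_degree2_eq) simp
  then show ?thesis
    using F G by (simp add: Brouwer_degree2_compose continuous_map_radial_field field_degree_def)
qed

lemma field_degree_additive_cover:
  assumes "field_on_sphere m f" "field_on_sphere m g" "field_on_sphere m f'" "field_on_sphere m g'"
    and "openin (nsphere m) U" "openin (nsphere m) V" "topspace (nsphere m) \<subseteq> U \<union> V"
    and U: "\<And>x i. \<lbrakk>x \<in> U; i \<le> m\<rbrakk> \<Longrightarrow> f x i = f' x i \<and> g x i = g' x i"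
    and V: "\<And>x i. \<lbrakk>x \<in> V; i \<le> m\<rbrakk> \<Longrightarrow> f x i = g x i \<and> f' x i = g' x i"
  shows "field_degree m f - field_degree m g = field_degree m f' - field_degree m g'"
  unfolding field_degree_def
proof (rule Brouwer_degree2_additive_cover[where U = U and V = V])
  show "\<And>x. x \<in> U \<Longrightarrow> radial m (f x) = radial m (f' x) \<and> radial m (g x) = radial m (g' x)"
    using U by (intro conjI radial_cong) auto
  show "\<And>x. x \<in> V \<Longrightarrow> radial m (f x) = radial m (g x) \<and> radial m (f' x) = radial m (g' x)"
    using V by (intro conjI radial_cong) auto
qed (use assms in \<open>auto intro: continuous_map_radial_field\<close>)

subsection \<open>Linear maps\<close>

definition mat_field :: "real mat \<Rightarrow> (nat \<Rightarrow> real) \<Rightarrow> nat \<Rightarrow> real" where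
  "mat_field A x i = (\<Sum>j<dim_col A. A $$ (i, j) * x j)"

lemma mat_field_eq_mult_vec:
  assumes "A \<in> carrier_mat n n" "i < n"
  shows "mat_field A x i = (A *\<^sub>v Matrix.vec n x) $ i"
  using assms by (simp add: mat_field_def scalar_prod_def atLeast0LessThan)

lemma continuous_map_mat_field: "continuous_map (nsphere m) euclideanreal (\<lambda>x. mat_field A x i)"
  unfolding mat_field_def by (intro continuous_intros continuous_map_nsphere_projection) auto

lemma field_on_sphere_mat_field:
  assumes A: "A \<in> carrier_mat (Suc m) (Suc m)" and det: "Determinant.det A \<noteq> 0"
  shows "field_on_sphere m (mat_field A)"
proof -
  have "\<exists>i\<le>m. mat_field A x i \<noteq> 0" if x: "x \<in> topspace (nsphere m)" for x
  proof (rule ccontr)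
    assume nz: "\<not> ?thesis"
    have "A *\<^sub>v Matrix.vec (Suc m) x = 0\<^sub>v (Suc m)"
    proof (intro eq_vecI)
      fix i assume "i < dim_vec (0\<^sub>v (Suc m) :: real vec)"
      then show "(A *\<^sub>v Matrix.vec (Suc m) x) $ i = 0\<^sub>v (Suc m) $ i"
        using nz mat_field_eq_mult_vec[OF A, of i x] by simp
    qed (use A in auto)
    moreover have "Matrix.vec (Suc m) x \<noteq> 0\<^sub>v (Suc m)"
    proof
      assume z: "Matrix.vec (Suc m) x = 0\<^sub>v (Suc m)"
      have "x i = 0" if "i \<le> m" for i
        using arg_cong[OF z, of "\<lambda>v. v $ i"] that by simp
      then show False using x by (simp add: topspace_nsphere)
    qed
    ultimately show False
      using det_0_iff_vec_prod_zero[OF A] det by (metis vec_carrier)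
  qed
  then show ?thesis by (simp add: field_on_sphere_def continuous_map_mat_field)
qed

lemma mat_field_mult:
  assumes "A \<in> carrier_mat n n" "B \<in> carrier_mat n n" "i < n"
  shows "mat_field (A * B) x i = mat_field A (mat_field B x) i"
proof -
  have "Matrix.vec n (mat_field B x) = B *\<^sub>v Matrix.vec n x"
    using assms by (intro eq_vecI) (auto simp: mat_field_eq_mult_vec[OF assms(2)])
  then show ?thesis
    using assms by (simp add: mat_field_eq_mult_vec[of _ n])
qed

lemma mat_field_scale: "mat_field A (\<lambda>j. c * y j) i = c * mat_field A y i"
  by (simp add: mat_field_def sum_distrib_left algebra_simps)

lemma field_degree_mat_compose:
  assumes A: "A \<in> carrier_mat (Suc m) (Suc m)" "Determinant.det A \<noteq> 0"
    and G: "field_on_sphere m G"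
  shows "field_degree m (\<lambda>x. mat_field A (G x)) = field_degree m (mat_field A) * field_degree m G"
proof (rule field_degree_compose)
  fix y z :: "nat \<Rightarrow> real" and i
  assume "\<And>j. j \<le> m \<Longrightarrow> y j = z j"
  then show "mat_field A y i = mat_field A z i"
    using A(1) by (auto simp: mat_field_def intro!: sum.cong)
qed (use assms in \<open>auto simp: field_on_sphere_mat_field mat_field_scale\<close>)

lemma field_degree_mat_mult:
  assumes A: "A \<in> carrier_mat (Suc m) (Suc m)" "Determinant.det A \<noteq> 0"
    and B: "B \<in> carrier_mat (Suc m) (Suc m)" "Determinant.det B \<noteq> 0"
  shows "field_degree m (mat_field (A * B)) = field_degree m (mat_field A) * field_degree m (mat_field B)"
proof -
  have "field_degree m (mat_field (A * B)) = field_degree m (\<lambda>x. mat_field A (mat_field B x))"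
    using A B by (intro field_degree_cong mat_field_mult) auto
  then show ?thesis
    using A B by (simp add: field_degree_mat_compose field_on_sphere_mat_field)
qed

lemma field_degree_mat_convex_homotopy:
  assumes A: "A \<in> carrier_mat (Suc m) (Suc m)" and B: "B \<in> carrier_mat (Suc m) (Suc m)"
    and det: "\<And>t. \<lbrakk>0 \<le> t; t \<le> 1\<rbrakk> \<Longrightarrow> Determinant.det ((1 - t) \<cdot>\<^sub>m A + t \<cdot>\<^sub>m B) \<noteq> 0"
  shows "field_degree m (mat_field A) = field_degree m (mat_field B)"
proof -
  define H where "H = (\<lambda>t x i. (1 - t) * mat_field A x i + t * mat_field B x i)"
  have H: "H t x i = mat_field ((1 - t) \<cdot>\<^sub>m A + t \<cdot>\<^sub>m B) x i" if "i \<le> m" for t x i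
    using A B that
    by (auto simp: H_def mat_field_def sum_distrib_left algebra_simps simp flip: sum.distrib
        intro!: sum.cong)
  have "field_degree m (H 0) = field_degree m (H 1)"
  proof (rule field_degree_homotopy)
    fix i
    show "continuous_map (prod_topology (top_of_set {0..1}) (nsphere m)) euclideanreal
        (\<lambda>p. H (fst p) (snd p) i)"
      unfolding H_def mat_field_def
      by (intro continuous_intros continuous_map_into_fulltopology[OF continuous_map_fst]
          continuous_map_compose[OF continuous_map_snd continuous_map_nsphere_projection, unfolded o_def]) auto
  next
    fix t x assume "0 \<le> (t::real)" "t \<le> 1" and x: "x \<in> topspace (nsphere m)"
    then have "field_on_sphere m (mat_field ((1 - t) \<cdot>\<^sub>m A + t \<cdot>\<^sub>m B))"
      using A B det by (intro field_on_sphere_mat_field) auto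
    then obtain i where "i \<le> m" "mat_field ((1 - t) \<cdot>\<^sub>m A + t \<cdot>\<^sub>m B) x i \<noteq> 0"
      using x unfolding field_on_sphere_def by blast
    then show "\<exists>i\<le>m. H t x i \<noteq> 0" using H by metis
  qed
  moreover have "field_degree m (H 0) = field_degree m (mat_field A)"
      "field_degree m (H 1) = field_degree m (mat_field B)"
    by (auto simp: H_def intro!: field_degree_cong)
  ultimately show ?thesis by simp
qed

section \<open>Invertible matrices as products of elementary ones\<close>

lemma addrow_undo:
  fixes a :: "'a :: comm_ring_1"
  assumes "A \<in> carrier_mat n n" "k < n" "l < n" "k \<noteq> l"
  shows "A = addrow_mat n (- a) k l * addrow a k l A"
proof -
  have "addrow_mat n (- a) k l * addrow a k l A = addrow (- a) k l (addrow a k l A)"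
    using assms by (intro addrow_mat[symmetric]) auto
  also have "\<dots> = A"
    using assms by (intro eq_matI) (auto simp: algebra_simps)
  finally show ?thesis by simp
qed

lemma multrow_undo:
  fixes a :: "'a :: field"
  assumes "A \<in> carrier_mat n n" "k < n" "a \<noteq> 0"
  shows "A = multrow_mat n k (inverse a) * multrow k a A"
proof -
  have "multrow_mat n k (inverse a) * multrow k a A = multrow k (inverse a) (multrow k a A)"
    using assms by (intro multrow_mat[symmetric]) auto
  also have "\<dots> = A"
    using assms by (intro eq_matI) auto
  finally show ?thesis by simp
qed

text \<open>Gauss-Jordan elimination, column by column, with each row operation undone by an
  elementary factor on the left. Row exchanges are avoided as generators: a zero pivot is repaired
  by adding a later row to the pivot row.\<close>

lemma invertible_mat_elementary_induct [consumes 2, case_names one addrow multrow mult]: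
  fixes A :: "'a :: field mat"
  assumes A: "A \<in> carrier_mat n n" "Determinant.det A \<noteq> 0"
    and one: "P (1\<^sub>m n)"
    and addrow: "\<And>a k l. \<lbrakk>k < n; l < n; k \<noteq> l\<rbrakk> \<Longrightarrow> P (addrow_mat n a k l)"
    and multrow: "\<And>a k. \<lbrakk>k < n; a \<noteq> 0\<rbrakk> \<Longrightarrow> P (multrow_mat n k a)"
    and mult: "\<And>A B. \<lbrakk>A \<in> carrier_mat n n; B \<in> carrier_mat n n; Determinant.det A \<noteq> 0;
        Determinant.det B \<noteq> 0; P A; P B\<rbrakk> \<Longrightarrow> P (A * B)"
  shows "P A"
proof -
  \<comment> \<open>The first \<open>j\<close> columns are already those of the identity; the outer
    induction runs over the number of remaining columns.\<close>
  define unit where "unit = (\<lambda>j (A :: 'a mat). \<forall>c<j. \<forall>i<n. A $$ (i, c) = (if i = c then 1 else 0))"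
  have add_step: "P A" if "A \<in> carrier_mat n n" "Determinant.det A \<noteq> 0" "k < n" "l < n" "k \<noteq> l"
    "P (addrow a k l A)" for A a k l
  proof -
    have "Determinant.det (addrow a k l A) = Determinant.det A"
      using that by (intro det_addrow) auto
    then have "P (addrow_mat n (- a) k l * addrow a k l A)"
      using that addrow[of k l "- a"] by (intro mult) (auto simp: det_addrow_mat)
    then show ?thesis by (simp only: addrow_undo[OF that(1,3-5), of a, symmetric])
  qed
  have mult_step: "P A" if "A \<in> carrier_mat n n" "Determinant.det A \<noteq> 0" "k < n" "a \<noteq> 0"
    "P (multrow k a A)" for A a k
  proof -
    have "Determinant.det (multrow k a A) = a * Determinant.det A"
      using that by (intro det_multrow) auto
    then have "P (multrow_mat n k (inverse a) * multrow k a A)"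
      using that multrow[of k "inverse a"] by (intro mult) (auto simp: det_multrow_mat)
    then show ?thesis by (simp only: multrow_undo[OF that(1,3,4), symmetric])
  qed
  have main: "P A" if "j \<le> n" "A \<in> carrier_mat n n" "Determinant.det A \<noteq> 0" "unit (n - j) A" for j A
    using that
  proof (induction j arbitrary: A)
    case 0
    then have "A = 1\<^sub>m n" by (intro eq_matI) (auto simp: unit_def)
    then show ?case using one by simp
  next
    case (Suc j)
    define c where "c = n - Suc j"
    have c: "c < n" "n - j = Suc c" using Suc.prems by (auto simp: c_def)
    \<comment> \<open>Inner induction within column \<open>c\<close>, whose pivot is 1: the rows
      from \<open>p\<close> on are already cleared, so \<open>p = n\<close> asks for nothing and
      \<open>p = 0\<close> means that the column is finished.\<close>
    have clear: "P A" if "p \<le> n" "A \<in> carrier_mat n n" "Determinant.det A \<noteq> 0" "unit c A" "A $$ (c, c) = 1"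
        "\<forall>i<n. p \<le> i \<and> i \<noteq> c \<longrightarrow> A $$ (i, c) = 0" for p A
      using that
    proof (induction p arbitrary: A)
      case 0
      then have "unit (n - j) A"
        unfolding c(2) by (auto simp: unit_def less_Suc_eq)
      then show ?case using Suc.IH[of A] Suc.prems 0 by simp
    next
      case (Suc p)
      show ?case
      proof (cases "p = c")
        case True
        have "A $$ (i, c) = 0" if "i < n" "p \<le> i" "i \<noteq> c" for i
        proof -
          have "Suc p \<le> i" using that True by simp
          then show ?thesis using Suc.prems(6) that by blast
        qed
        then have "\<forall>i<n. p \<le> i \<and> i \<noteq> c \<longrightarrow> A $$ (i, c) = 0" by blast
        then show ?thesis by (rule Suc.IH[OF Suc_leD[OF Suc.prems(1)] Suc.prems(2-5)])
      next
        case False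
        let ?B = "addrow (- A $$ (p, c)) p c A"
        have pn: "p < n" using Suc.prems by simp
        have "P ?B"
        proof (rule Suc.IH)
          show "Determinant.det ?B \<noteq> 0"
            using Suc.prems det_addrow[of c n p A "- A $$ (p, c)"] c False by auto
          show "unit c ?B" using Suc.prems c pn by (auto simp: unit_def)
          show "?B $$ (c, c) = 1" using Suc.prems c pn False by auto
          show "\<forall>i<n. p \<le> i \<and> i \<noteq> c \<longrightarrow> ?B $$ (i, c) = 0"
            using Suc.prems c pn False by (auto simp: le_less Suc_le_eq)
        qed (use Suc.prems in auto)
        then show ?thesis using Suc.prems pn c False add_step by blast
      qed
    qed
    have nz: "P A" if "A \<in> carrier_mat n n" "Determinant.det A \<noteq> 0" "unit c A" "A $$ (c, c) \<noteq> 0" for A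
    proof -
      let ?B = "multrow c (inverse (A $$ (c, c))) A"
      have "P ?B"
      proof (rule clear[OF order_refl])
        show "Determinant.det ?B \<noteq> 0"
          using that c det_multrow[of c n A "inverse (A $$ (c, c))"] by auto
        show "unit c ?B" using that c by (auto simp: unit_def)
        show "?B $$ (c, c) = 1" using that c by auto
      qed (use that in auto)
      then show ?thesis using that c mult_step[of A c "inverse (A $$ (c, c))"] by simp
    qed
    have uc: "unit c A" using Suc.prems by (simp add: c_def)
    have "\<exists>i. c \<le> i \<and> i < n \<and> A $$ (i, c) \<noteq> 0"
    proof (rule ccontr)
      assume "\<not> ?thesis"
      then have z: "A $$ (i, c) = 0" if "c \<le> i" "i < n" for i using that by blast
      \<comment> \<open>Without a pivot at or below the diagonal, column \<open>c\<close> would be a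
        combination of the earlier unit columns; \<open>w\<close> holds the coefficients of this
        dependence and lies in the kernel.\<close>
      define w where "w = Matrix.vec n (\<lambda>j. if j = c then 1 else if j < c then - A $$ (j, c) else 0)"
      have "(A *\<^sub>v w) $ i = 0" if i: "i < n" for i
      proof -
        have "(A *\<^sub>v w) $ i = (\<Sum>j\<in>{0..<n}. A $$ (i, j) * w $ j)"
          using Suc.prems i by (simp add: scalar_prod_def w_def)
        also have "\<dots> = (\<Sum>j\<in>{0..<n}. (if j = c then A $$ (i, c) else 0) +
            (if j = i then if i < c then - A $$ (i, c) else 0 else 0))"
        proof (intro sum.cong refl)
          fix j assume "j \<in> {0..<n}"
          then show "A $$ (i, j) * w $ j = (if j = c then A $$ (i, c) else 0) +
              (if j = i then if i < c then - A $$ (i, c) else 0 else 0)"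
            using uc i by (auto simp: w_def unit_def)
        qed
        also have "\<dots> = A $$ (i, c) + (if i < c then - A $$ (i, c) else 0)"
          using i c by (simp add: sum.distrib)
        finally show ?thesis using z[of i] i by (auto simp: not_less)
      qed
      then have "A *\<^sub>v w = 0\<^sub>v n" using Suc.prems by (intro eq_vecI) auto
      moreover have "w $ c \<noteq> 0\<^sub>v n $ c" using c by (simp add: w_def)
      then have "w \<noteq> 0\<^sub>v n" by metis
      moreover have "w \<in> carrier_vec n" by (simp add: w_def)
      ultimately show False
        using det_0_iff_vec_prod_zero[of A n] Suc.prems by blast
    qed
    then obtain i where i: "c \<le> i" "i < n" "A $$ (i, c) \<noteq> 0" by blast
    show ?case
    proof (cases "A $$ (c, c) = 0")
      case False
      then show ?thesis using nz Suc.prems uc by blast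
    next
      case True
      then have ic: "i \<noteq> c" using i by auto
      have "P (addrow 1 c i A)"
      proof (rule nz)
        show "Determinant.det (addrow 1 c i A) \<noteq> 0"
          using Suc.prems det_addrow[of i n c A 1] i ic by auto
        show "unit c (addrow 1 c i A)" using Suc.prems uc c i by (auto simp: unit_def)
        show "addrow 1 c i A $$ (c, c) \<noteq> 0" using Suc.prems c i True by auto
      qed (use Suc.prems in auto)
      then show ?thesis using Suc.prems c i ic add_step[of A c i 1] by simp
    qed
  qed
  show ?thesis using main[of n A] A by (simp add: unit_def)
qed

text \<open>Exchanging two coordinates is an involution conjugating the two reflections.\<close>

lemma field_degree_reflection:
  assumes "k \<le> m"
  shows "field_degree m (mat_field (multrow_mat (Suc m) k (- 1))) = - 1"
proof -
  let ?n = "Suc m" and ?S = "swaprows_mat (Suc m) 0 k :: real mat"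
  let ?R = "\<lambda>k. multrow_mat (Suc m) k (- 1) :: real mat"
  have R: "mat_field (?R k) x i = (if i = k then - x i else x i)" if "i \<le> m" for k x i
  proof -
    have "mat_field (?R k) x i = (\<Sum>j<?n. if j = i then (if i = k then - x i else x i) else 0)"
      unfolding mat_field_def using that by (intro sum.cong) auto
    then show ?thesis using that by simp
  qed
  have R0: "field_degree m (mat_field (?R 0)) = - 1"
  proof -
    have "field_degree m (mat_field (?R 0)) = field_degree m (\<lambda>x i. if i = 0 then - x i else x i)"
      by (rule field_degree_cong) (simp add: R)
    also have "\<dots> = Brouwer_degree2 m (\<lambda>x i. if i = 0 then - x i else x i)"
      unfolding field_degree_def
    proof (rule Brouwer_degree2_eq, rule radial_on_sphere)
      fix x assume "x \<in> topspace (nsphere m)"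
      moreover have "(\<Sum>i\<le>m. (if i = 0 then - x i else x i)\<^sup>2) = (\<Sum>i\<le>m. (x i)\<^sup>2)"
        by (intro sum.cong) auto
      ultimately show "(\<lambda>i. if i = 0 then - x i else x i) \<in> topspace (nsphere m)"
        by (simp add: topspace_nsphere)
    qed
    finally show ?thesis by (simp add: Brouwer_degree2_reflection)
  qed
  show ?thesis
  proof (cases "k = 0")
    case False
    have S: "?S \<in> carrier_mat ?n ?n" "Determinant.det ?S \<noteq> 0" "?S * ?S = 1\<^sub>m ?n"
      using assms False by (auto simp: det_swaprows_mat swaprows_mat_inv)
    have "?S * (?R 0 * ?S) = swaprows 0 k (multrow 0 (- 1) (swaprows 0 k (1\<^sub>m ?n)))"
    proof -
      have "swaprows 0 k (1\<^sub>m ?n) = ?S * 1\<^sub>m ?n"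
        using assms by (intro swaprows_mat) auto
      then have "swaprows 0 k (1\<^sub>m ?n) = ?S" by simp
      then show ?thesis
        using assms multrow_mat[OF S(1), of 0 "- 1"]
          swaprows_mat[of "multrow 0 (- 1) ?S" ?n ?n 0 k]
          mult_carrier_mat[of "?R 0" ?n ?n ?S ?n] by simp
    qed
    also have "\<dots> = ?R k"
      using assms False by (intro eq_matI) auto
    finally have "field_degree m (mat_field (?R k)) = field_degree m (mat_field (?S * (?R 0 * ?S)))"
      by simp
    also have "\<dots> = field_degree m (mat_field ?S) * (field_degree m (mat_field (?R 0)) * field_degree m (mat_field ?S))"
      using S by (subst field_degree_mat_mult) (auto simp: field_degree_mat_mult det_multrow_mat det_mult[of _ ?n])
    \<comment> \<open>The degree of the exchange occurs squared, so its sign need not be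
      known.\<close>
    also have "\<dots> = - field_degree m (mat_field (?S * ?S))"
      unfolding field_degree_mat_mult[OF S(1,2) S(1,2)] R0 by simp
    also have "field_degree m (mat_field (?S * ?S)) = field_degree m (\<lambda>x. x)"
      unfolding S(3)
      by (rule field_degree_cong) (auto simp: mat_field_eq_mult_vec[of _ ?n])
    finally show ?thesis by (simp add: field_degree_id)
  qed (simp add: R0)
qed

text \<open>Both sides are multiplicative, so generators suffice. A shear is joined to the identity
  by shrinking its off-diagonal entry; a scaling by \<open>a\<close> is joined to the scaling by
  \<open>sgn a\<close> through factors of the same sign, which leaves the identity or a
  reflection.\<close>

theorem field_degree_mat_field:
  assumes "A \<in> carrier_mat (Suc m) (Suc m)" "Determinant.det A \<noteq> 0"
  shows "real_of_int (field_degree m (mat_field A)) = sgn (Determinant.det A)"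
  using assms
proof (induction rule: invertible_mat_elementary_induct)
  let ?n = "Suc m"
  have one: "field_degree m (mat_field (1\<^sub>m ?n)) = 1"
  proof -
    have "field_degree m (mat_field (1\<^sub>m ?n)) = field_degree m (\<lambda>x. x)"
      by (rule field_degree_cong) (auto simp: mat_field_eq_mult_vec[of _ ?n])
    then show ?thesis by (simp add: field_degree_id)
  qed
  {
    case one
    then show ?case using \<open>field_degree m (mat_field (1\<^sub>m ?n)) = 1\<close> by simp
  next
    case (addrow a k l)
    have "field_degree m (mat_field (1\<^sub>m ?n)) = field_degree m (mat_field (addrow_mat ?n a k l))"
    proof (rule field_degree_mat_convex_homotopy)
      fix t :: real
      have "(1 - t) \<cdot>\<^sub>m 1\<^sub>m ?n + t \<cdot>\<^sub>m addrow_mat ?n a k l = addrow_mat ?n (t * a) k l"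
        by (intro eq_matI) (auto simp: algebra_simps)
      then show "Determinant.det ((1 - t) \<cdot>\<^sub>m 1\<^sub>m ?n + t \<cdot>\<^sub>m addrow_mat ?n a k l) \<noteq> 0"
        using addrow by (simp add: det_addrow_mat)
    qed auto
    then show ?case using addrow \<open>field_degree m (mat_field (1\<^sub>m ?n)) = 1\<close> by (simp add: det_addrow_mat)
  next
    case (multrow a k)
    let ?c = "sgn a"
    have "field_degree m (mat_field (multrow_mat ?n k ?c)) = field_degree m (mat_field (multrow_mat ?n k a))"
    proof (rule field_degree_mat_convex_homotopy)
      fix t :: real assume t: "0 \<le> t" "t \<le> 1"
      have "(1 - t) \<cdot>\<^sub>m multrow_mat ?n k ?c + t \<cdot>\<^sub>m multrow_mat ?n k a
          = multrow_mat ?n k ((1 - t) * ?c + t * a)"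
        by (intro eq_matI) (auto simp: algebra_simps)
      moreover have "(1 - t) * ?c + t * a = ((1 - t) + t * \<bar>a\<bar>) * ?c"
        by (simp add: algebra_simps abs_mult_sgn sgn_mult_abs flip: mult.assoc)
      moreover have "(1 - t) + t * \<bar>a\<bar> > 0"
        using t multrow by (cases "t = 1") (auto intro: add_pos_nonneg)
      ultimately show "Determinant.det ((1 - t) \<cdot>\<^sub>m multrow_mat ?n k ?c + t \<cdot>\<^sub>m multrow_mat ?n k a) \<noteq> 0"
        using multrow by (simp add: det_multrow_mat sgn_zero_iff)
    qed auto
    moreover have "multrow_mat ?n k 1 = (1\<^sub>m ?n :: real mat)"
      by (intro eq_matI) auto
    ultimately show ?case
      using multrow \<open>field_degree m (mat_field (1\<^sub>m ?n)) = 1\<close> field_degree_reflection[of k m]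
      by (cases "a > 0") (auto simp: det_multrow_mat)
  next
    case (mult A B)
    then show ?case by (simp add: field_degree_mat_mult det_mult[of _ ?n] sgn_mult)
  }
qed

subsection \<open>Crossings of a pencil\<close>

text \<open>\<open>\<phi>\<close> is a time profile on the sphere. The degree depends only on which
  crossings lie below the graph of the profile, as long as the graph avoids them all.\<close>

definition pencil_field ::
    "((nat \<Rightarrow> real) \<Rightarrow> nat \<Rightarrow> real) \<Rightarrow> ((nat \<Rightarrow> real) \<Rightarrow> real) \<Rightarrow> (nat \<Rightarrow> real) \<Rightarrow> nat \<Rightarrow> real" where
  "pencil_field C \<phi> x = (\<lambda>i. x i - \<phi> x * C x i)"

definition crossing :: "nat \<Rightarrow> ((nat \<Rightarrow> real) \<Rightarrow> nat \<Rightarrow> real) \<Rightarrow> real \<Rightarrow> (nat \<Rightarrow> real) \<Rightarrow> bool" where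
  "crossing m C s x \<longleftrightarrow> (\<forall>i\<le>m. x i = s * C x i)"

lemma field_on_sphere_pencil:
  assumes "\<And>i. i \<le> m \<Longrightarrow> continuous_map (nsphere m) euclideanreal (\<lambda>x. C x i)"
    and "continuous_map (nsphere m) euclideanreal \<phi>"
    and "\<And>x. x \<in> topspace (nsphere m) \<Longrightarrow> \<not> crossing m C (\<phi> x) x"
  shows "field_on_sphere m (pencil_field C \<phi>)"
  using assms unfolding field_on_sphere_def pencil_field_def crossing_def
  by (auto intro!: continuous_intros continuous_map_nsphere_projection)

lemma field_degree_pencil_homotopy:
  assumes C: "\<And>i. i \<le> m \<Longrightarrow> continuous_map (nsphere m) euclideanreal (\<lambda>x. C x i)"
    and \<phi>: "continuous_map (nsphere m) euclideanreal \<phi>"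
    and \<psi>: "continuous_map (nsphere m) euclideanreal \<psi>"
    and nz: "\<And>x s. \<lbrakk>x \<in> topspace (nsphere m); s \<in> closed_segment (\<phi> x) (\<psi> x)\<rbrakk> \<Longrightarrow> \<not> crossing m C s x"
  shows "field_degree m (pencil_field C \<phi>) = field_degree m (pencil_field C \<psi>)"
proof -
  define H where "H = (\<lambda>t. pencil_field C (\<lambda>x. (1 - t) * \<phi> x + t * \<psi> x))"
  have snd: "continuous_map (prod_topology (top_of_set {0..1::real}) (nsphere m)) euclideanreal (\<lambda>p. g (snd p))"
    if "continuous_map (nsphere m) euclideanreal g" for g :: "(nat \<Rightarrow> real) \<Rightarrow> real"
    using continuous_map_compose[OF continuous_map_snd that] by (simp add: o_def)
  have "field_degree m (H 0) = field_degree m (H 1)"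
  proof (rule field_degree_homotopy)
    fix i assume "i \<le> m"
    then show "continuous_map (prod_topology (top_of_set {0..1}) (nsphere m)) euclideanreal
        (\<lambda>p. H (fst p) (snd p) i)"
      unfolding H_def pencil_field_def
      by (intro continuous_intros continuous_map_into_fulltopology[OF continuous_map_fst]
          snd continuous_map_nsphere_projection C \<phi> \<psi>)
  next
    fix t x assume "0 \<le> (t::real)" "t \<le> 1" and x: "x \<in> topspace (nsphere m)"
    then have "(1 - t) * \<phi> x + t * \<psi> x \<in> closed_segment (\<phi> x) (\<psi> x)"
      by (auto simp: closed_segment_def)
    from nz[OF x this] show "\<exists>i\<le>m. H t x i \<noteq> 0"
      by (auto simp: crossing_def H_def pencil_field_def)
  qed
  then show ?thesis by (simp add: H_def)
qed

lemma topspace_nsphere_minus: "x \<in> topspace (nsphere m) \<Longrightarrow> (\<lambda>i. - x i) \<in> topspace (nsphere m)"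
  by (simp add: topspace_nsphere)

lemma radial_minus: "radial m (\<lambda>i. - y i) = (\<lambda>i. - radial m y i)"
  by (auto simp: radial_def)

text \<open>The antipodal map is an involution. Its degree, whose sign varies with the dimension,
  enters once on each side of \<open>F\<close>, and its square is 1.\<close>

lemma field_degree_antipodal_conj:
  assumes F: "field_on_sphere m F"
  shows "field_degree m (\<lambda>x i. - F (\<lambda>j. - x j) i) = field_degree m F"
proof -
  let ?a = "\<lambda>x i. - x i :: real"
  have a: "field_on_sphere m ?a"
    unfolding field_on_sphere_def
  proof (intro conjI allI impI ballI)
    fix x assume "x \<in> topspace (nsphere m)"
    then have "0 < (\<Sum>j\<le>m. (x j)\<^sup>2)" by (simp add: topspace_nsphere)
    then show "\<exists>i\<le>m. - x i \<noteq> 0" by (simp add: sum_squares_pos_iff)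
  qed (intro continuous_intros continuous_map_nsphere_projection)
  have "field_degree m (\<lambda>x. ?a (?a x)) = field_degree m ?a * field_degree m ?a"
    using a by (rule field_degree_compose[OF a]) (auto simp: algebra_simps)
  then have aa: "field_degree m ?a * field_degree m ?a = 1"
    by (simp add: field_degree_id)
  have FA: "field_on_sphere m (\<lambda>x. F (?a x))"
  proof -
    have "continuous_map (nsphere m) euclideanreal (\<lambda>x. F (?a x) i)" if "i \<le> m" for i
    proof -
      have "continuous_map (nsphere m) (nsphere m) (\<lambda>x. radial m (?a x))"
        by (rule continuous_map_radial_field[OF a])
      then have "continuous_map (nsphere m) (nsphere m) ?a"
        by (rule continuous_map_eq) (simp add: radial_minus radial_on_sphere)
      then show ?thesis
        using F that continuous_map_compose[of _ _ ?a _ "\<lambda>x. F x i"]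
        by (auto simp: field_on_sphere_def o_def)
    qed
    then show ?thesis using F by (auto simp: field_on_sphere_def topspace_nsphere_minus)
  qed
  have "field_degree m (\<lambda>x. ?a (F (?a x))) = field_degree m ?a * field_degree m (\<lambda>x. F (?a x))"
    by (rule field_degree_compose[OF a FA]) (auto simp: algebra_simps)
  also have "field_degree m (\<lambda>x. F (?a x)) = field_degree m F * field_degree m ?a"
  proof -
    have "field_degree m (\<lambda>x. F (?a x)) = Brouwer_degree2 m ((\<lambda>x. radial m (F x)) \<circ> (\<lambda>x. radial m (?a x)))"
      unfolding field_degree_def
      by (rule Brouwer_degree2_eq) (simp add: radial_minus radial_on_sphere)
    then show ?thesis
      using F a by (simp add: Brouwer_degree2_compose continuous_map_radial_field field_degree_def)
  qed
  finally show ?thesis using aa by (simp add: algebra_simps)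
qed

text \<open>For odd \<open>D\<close>, conjugation by the antipodal map only moves the profile to the
  antipodal points.\<close>

lemma field_degree_odd_pencil_reflect:
  assumes "field_on_sphere m (pencil_field D \<phi>)"
    and "\<And>x i. D (\<lambda>j. - x j) i = - D x i"
  shows "field_degree m (pencil_field D (\<lambda>x. \<phi> (\<lambda>j. - x j))) = field_degree m (pencil_field D \<phi>)"
proof -
  have "pencil_field D (\<lambda>x. \<phi> (\<lambda>j. - x j)) = (\<lambda>x i. - pencil_field D \<phi> (\<lambda>j. - x j) i)"
    by (simp add: pencil_field_def fun_eq_iff assms(2))
  then show ?thesis using field_degree_antipodal_conj[OF assms(1)] by simp
qed

text \<open>Across the crossing of an odd pencil the degree jumps by equal amounts at \<open>z\<close> and
  \<open>- z\<close>; a bump at \<open>z\<close> alone therefore sees half of the total jump.\<close>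

lemma odd_crossing_half_jump:
  assumes D: "\<And>i. i \<le> m \<Longrightarrow> continuous_map (nsphere m) euclideanreal (\<lambda>x. D x i)"
    and odd: "\<And>x i. D (\<lambda>j. - x j) i = - D x i"
    and z: "z \<in> topspace (nsphere m)" and ab: "a < s0" "s0 < b"
    and only: "\<And>s x. \<lbrakk>a \<le> s; s \<le> b; x \<in> topspace (nsphere m); crossing m D s x\<rbrakk>
        \<Longrightarrow> s = s0 \<and> (x = z \<or> x = (\<lambda>i. - z i))"
    and w: "continuous_map (nsphere m) euclideanreal w"
      "\<And>x. x \<in> topspace (nsphere m) \<Longrightarrow> 0 \<le> w x \<and> w x \<le> 1" "w z = 1" "w (\<lambda>i. - z i) = 0"
  shows "2 * (field_degree m (pencil_field D (\<lambda>x. a + (b - a) * w x))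
            - field_degree m (pencil_field D (\<lambda>x. a)))
       = field_degree m (pencil_field D (\<lambda>x. b)) - field_degree m (pencil_field D (\<lambda>x. a))"
proof -
  let ?S = "topspace (nsphere m)"
  let ?E = "\<lambda>u. field_degree m (pencil_field D (\<lambda>x. a + (b - a) * u x))"
  define ip where "ip = (\<lambda>x. \<Sum>i\<le>m. x i * z i)"
  \<comment> \<open>Concrete bumps on the caps around \<open>z\<close> and \<open>- z\<close>:
    \<open>w1\<close> lives where \<open>ip\<close> exceeds 1/2 and \<open>w2\<close> is its mirror
    image, so their supports are disjoint.\<close>
  define w1 where "w1 = (\<lambda>x. min 1 (max 0 (2 * ip x - 1)))"
  define w2 where "w2 = (\<lambda>x. min 1 (max 0 (- 2 * ip x - 1)))"
  have ip: "continuous_map (nsphere m) euclideanreal ip"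
    unfolding ip_def by (intro continuous_intros continuous_map_nsphere_projection) auto
  have cw: "continuous_map (nsphere m) euclideanreal w1" "continuous_map (nsphere m) euclideanreal w2"
    unfolding w1_def w2_def by (intro continuous_intros ip; simp)+
  have ipz: "ip z = 1" "ip (\<lambda>i. - z i) = - 1"
    using z by (auto simp: ip_def topspace_nsphere power2_eq_square sum_negf)
  have w21: "w2 = (\<lambda>x. w1 (\<lambda>j. - x j))"
    by (simp add: w1_def w2_def ip_def sum_negf)
  have vals: "a \<le> a + (b - a) * t" "a + (b - a) * t \<le> b" if "0 \<le> t" "t \<le> 1" for t
  proof -
    have "0 \<le> (b - a) * t" "(b - a) * t \<le> b - a" using that ab by (auto intro: mult_left_le)
    then show "a \<le> a + (b - a) * t" "a + (b - a) * t \<le> b" by linarith+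
  qed
  have ne: "a + (b - a) * t \<noteq> s0" if "t = 0 \<or> t = 1" for t using that ab by auto
  have fos: "field_on_sphere m (pencil_field D (\<lambda>x. a + (b - a) * u x))"
    if "continuous_map (nsphere m) euclideanreal u" "\<And>x. x \<in> ?S \<Longrightarrow> 0 \<le> u x \<and> u x \<le> 1"
      "u z = 0 \<or> u z = 1" "u (\<lambda>i. - z i) = 0 \<or> u (\<lambda>i. - z i) = 1" for u
  proof (rule field_on_sphere_pencil)
    fix x assume x: "x \<in> ?S"
    show "\<not> crossing m D (a + (b - a) * u x) x"
    proof
      assume "crossing m D (a + (b - a) * u x) x"
      then have "a + (b - a) * u x = s0" "x = z \<or> x = (\<lambda>i. - z i)"
        using only[OF _ _ x, of "a + (b - a) * u x"] vals[of "u x"] that(2)[OF x] by auto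
      then show False using ne[of "u x"] that(3,4) by auto
    qed
  qed (auto intro!: D continuous_intros that(1))
  \<comment> \<open>Crossings occur only over \<open>z\<close> and \<open>- z\<close>. There the two
    profiles agree and equal \<open>a\<close> or \<open>b\<close>, never \<open>s0\<close>, so the
    straight homotopy between them meets no crossing.\<close>
  have hom: "?E u = ?E v"
    if "continuous_map (nsphere m) euclideanreal u" "\<And>x. x \<in> ?S \<Longrightarrow> 0 \<le> u x \<and> u x \<le> 1"
      "continuous_map (nsphere m) euclideanreal v" "\<And>x. x \<in> ?S \<Longrightarrow> 0 \<le> v x \<and> v x \<le> 1"
      "u z = v z" "u (\<lambda>i. - z i) = v (\<lambda>i. - z i)"
      "u z = 0 \<or> u z = 1" "u (\<lambda>i. - z i) = 0 \<or> u (\<lambda>i. - z i) = 1" for u v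
  proof (rule field_degree_pencil_homotopy)
    fix x s assume x: "x \<in> ?S" and s: "s \<in> closed_segment (a + (b - a) * u x) (a + (b - a) * v x)"
    have "closed_segment (a + (b - a) * u x) (a + (b - a) * v x) \<subseteq> {a..b}"
      using vals that(2,4)[OF x] by (intro closed_segment_subset) auto
    then have "a \<le> s" "s \<le> b" using s by auto
    show "\<not> crossing m D s x"
    proof
      assume "crossing m D s x"
      then have *: "s = s0" "x = z \<or> x = (\<lambda>i. - z i)"
        using only[OF \<open>a \<le> s\<close> \<open>s \<le> b\<close> x] by auto
      then have "u x = v x" "u x = 0 \<or> u x = 1" using that(5-8) by auto
      then show False using s * ne[of "u x"] by simp
    qed
  qed (auto intro!: D continuous_intros that)
  have rng: "0 \<le> w1 x \<and> w1 x \<le> 1" "0 \<le> w2 x \<and> w2 x \<le> 1" "0 \<le> w1 x + w2 x \<and> w1 x + w2 x \<le> 1" for x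
    by (auto simp: w1_def w2_def)
  have at: "w1 z = 1" "w1 (\<lambda>i. - z i) = 0" "w2 z = 0" "w2 (\<lambda>i. - z i) = 1"
    by (simp_all add: w1_def w2_def ipz)
  have c12: "continuous_map (nsphere m) euclideanreal (\<lambda>x. w1 x + w2 x)"
    by (intro continuous_intros cw)
  have 1: "?E w = ?E w1"
    using w cw rng at by (intro hom) auto
  have 2: "?E (\<lambda>x. w1 x + w2 x) = ?E (\<lambda>x. 1)"
    using c12 rng at by (intro hom) auto
  have 3: "?E w2 = ?E w1"
  proof -
    have "field_on_sphere m (pencil_field D (\<lambda>x. a + (b - a) * w1 x))"
      using cw rng at by (intro fos) auto
    then show ?thesis
      unfolding w21 by (rule field_degree_odd_pencil_reflect) (rule odd)
  qed
  have op: "openin (nsphere m) {x \<in> ?S. ip x \<in> {-1/2<..}}" "openin (nsphere m) {x \<in> ?S. ip x \<in> {..<1/2}}"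
    by (intro openin_continuous_map_preimage[OF ip]; simp)+
  \<comment> \<open>Raising the profile at \<open>z\<close> has the same effect whether or not it
    has been raised at \<open>- z\<close>. With 2 and 3 this reads
    \<open>2 * ?E w1 = ?E 1 + ?E 0\<close> for the constant profiles.\<close>
  have 4: "?E w1 - ?E (\<lambda>x. 0) = ?E (\<lambda>x. w1 x + w2 x) - ?E w2"
  proof (rule field_degree_additive_cover[OF fos fos fos fos op])
    show "?S \<subseteq> {x \<in> ?S. ip x \<in> {-1/2<..}} \<union> {x \<in> ?S. ip x \<in> {..<1/2}}" by auto
    fix x i
    show "pencil_field D (\<lambda>x. a + (b - a) * w1 x) x i = pencil_field D (\<lambda>x. a + (b - a) * (w1 x + w2 x)) x i \<and>
        pencil_field D (\<lambda>x. a + (b - a) * 0) x i = pencil_field D (\<lambda>x. a + (b - a) * w2 x) x i"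
      if "x \<in> {x \<in> ?S. ip x \<in> {-1/2<..}}"
    proof -
      have "w2 x = 0" using that by (simp add: w2_def)
      then show ?thesis by (simp add: pencil_field_def)
    qed
    show "pencil_field D (\<lambda>x. a + (b - a) * w1 x) x i = pencil_field D (\<lambda>x. a + (b - a) * 0) x i \<and>
        pencil_field D (\<lambda>x. a + (b - a) * (w1 x + w2 x)) x i = pencil_field D (\<lambda>x. a + (b - a) * w2 x) x i"
      if "x \<in> {x \<in> ?S. ip x \<in> {..<1/2}}"
    proof -
      have "w1 x = 0" using that by (simp add: w1_def)
      then show ?thesis by (simp add: pencil_field_def)
    qed
  qed (use cw c12 rng at in simp_all)
  show ?thesis using 1 2 3 4 by simp
qed

section \<open>Passing the crossings one at a time\<close>

definition sqdist :: "nat \<Rightarrow> (nat \<Rightarrow> real) \<Rightarrow> (nat \<Rightarrow> real) \<Rightarrow> real" where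
  "sqdist m x y = (\<Sum>i\<le>m. (x i - y i)\<^sup>2)"

lemma sqdist_self [simp]: "sqdist m x x = 0"
  by (simp add: sqdist_def)

lemma sqdist_pos:
  assumes "x \<in> topspace (nsphere m)" "y \<in> topspace (nsphere m)" "x \<noteq> y"
  shows "0 < sqdist m x y"
  using assms sum_squares_pos_iff[of "\<lambda>i. x i - y i" m] nsphere_eqI[of x m y]
  by (auto simp: sqdist_def)

text \<open>The factor 2 accounts for the second crossing of the odd model, at \<open>- z\<close>.\<close>

definition odd_model ::
    "nat \<Rightarrow> ((nat \<Rightarrow> real) \<Rightarrow> nat \<Rightarrow> real) \<Rightarrow> (nat \<Rightarrow> real) \<Rightarrow> real \<Rightarrow> int \<Rightarrow> bool" where
  "odd_model m C z s0 \<kappa> \<longleftrightarrow> (\<exists>D a b r. 0 < r \<and> 0 \<le> a \<and> a < s0 \<and> s0 < b \<and> b \<le> 1 \<and>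
     (\<forall>i\<le>m. continuous_map (nsphere m) euclideanreal (\<lambda>x. D x i)) \<and>
     (\<forall>x i. D (\<lambda>j. - x j) i = - D x i) \<and>
     (\<forall>x\<in>topspace (nsphere m). sqdist m x z < r \<longrightarrow> (\<forall>i\<le>m. C x i = D x i)) \<and>
     (\<forall>s x. a \<le> s \<and> s \<le> b \<and> x \<in> topspace (nsphere m) \<and> crossing m D s x
        \<longrightarrow> s = s0 \<and> (x = z \<or> x = (\<lambda>i. - z i))) \<and>
     2 * \<kappa> = field_degree m (pencil_field D (\<lambda>x. b)) - field_degree m (pencil_field D (\<lambda>x. a)))"

text \<open>The profile is lowered near \<open>z\<close> in two moves. The first, to
  \<open>\<theta>\<close>, stays above \<open>s0\<close> at \<open>z\<close> and is a homotopy; it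
  gives the profile near \<open>z\<close> the shape of a bump over the level \<open>a\<close>. The
  second, to \<open>\<psi>\<close>, removes the bump; by additivity its effect can be read off in
  the odd model, where it is half of the total jump.\<close>

lemma push_through_crossing:
  assumes C: "\<And>i. i \<le> m \<Longrightarrow> continuous_map (nsphere m) euclideanreal (\<lambda>x. C x i)"
    and z: "z \<in> topspace (nsphere m)" and model: "odd_model m C z s0 \<kappa>"
    and \<phi>: "continuous_map (nsphere m) euclideanreal \<phi>"
      "\<And>x. x \<in> topspace (nsphere m) \<Longrightarrow> 0 \<le> \<phi> x \<and> \<phi> x \<le> 1"
    and \<rho>: "0 < \<rho>" "\<And>s x. \<lbrakk>0 \<le> s; s \<le> 1; x \<in> topspace (nsphere m); crossing m C s x; sqdist m x z < \<rho>\<rbrakk>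
        \<Longrightarrow> x = z \<and> s = s0"
    and off: "\<And>x. \<lbrakk>x \<in> topspace (nsphere m); x \<noteq> z\<rbrakk> \<Longrightarrow> \<not> crossing m C (\<phi> x) x"
    and above: "s0 < \<phi> z"
  shows "\<exists>\<psi>. continuous_map (nsphere m) euclideanreal \<psi> \<and>
    (\<forall>x\<in>topspace (nsphere m). 0 \<le> \<psi> x \<and> \<psi> x \<le> 1) \<and> \<psi> z < s0 \<and>
    (\<forall>x. \<rho> \<le> sqdist m x z \<longrightarrow> \<psi> x = \<phi> x) \<and>
    field_degree m (pencil_field C \<phi>) = field_degree m (pencil_field C \<psi>) + \<kappa>"
proof -
  let ?S = "topspace (nsphere m)"
  obtain D a b r0 where r0: "0 < r0" and ab: "0 \<le> a" "a < s0" "s0 < b" "b \<le> 1"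
    and D': "\<forall>i\<le>m. continuous_map (nsphere m) euclideanreal (\<lambda>x. D x i)"
    and odd': "\<forall>x i. D (\<lambda>j. - x j) i = - D x i"
    and CD': "\<forall>x\<in>?S. sqdist m x z < r0 \<longrightarrow> (\<forall>i\<le>m. C x i = D x i)"
    and only': "\<forall>s x. a \<le> s \<and> s \<le> b \<and> x \<in> ?S \<and> crossing m D s x \<longrightarrow> s = s0 \<and> (x = z \<or> x = (\<lambda>i. - z i))"
    and \<kappa>: "2 * \<kappa> = field_degree m (pencil_field D (\<lambda>x. b)) - field_degree m (pencil_field D (\<lambda>x. a))"
    using model unfolding odd_model_def by (elim exE conjE) (rule that)
  have D: "\<And>i. i \<le> m \<Longrightarrow> continuous_map (nsphere m) euclideanreal (\<lambda>x. D x i)"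
    and odd: "\<And>x i. D (\<lambda>j. - x j) i = - D x i"
    and CD: "\<And>x i. \<lbrakk>x \<in> ?S; sqdist m x z < r0; i \<le> m\<rbrakk> \<Longrightarrow> C x i = D x i"
    and only: "\<And>s x. \<lbrakk>a \<le> s; s \<le> b; x \<in> ?S; crossing m D s x\<rbrakk> \<Longrightarrow> s = s0 \<and> (x = z \<or> x = (\<lambda>i. - z i))"
    using D' odd' CD' only' by simp_all
  \<comment> \<open>Half of each radius leaves room: the changes to the profile end at
    \<open>2 * r\<close>, within \<open>\<rho>\<close>, and the bump lies where \<open>C\<close>
    agrees with \<open>D\<close>. The bound 1 keeps \<open>- z\<close>, at squared distance 4,
    outside the bump.\<close>
  define r where "r = min (min (r0 / 2) (\<rho> / 2)) 1"
  have r: "0 < r" "r < r0" "2 * r \<le> \<rho>" "r \<le> 1" using r0 \<rho>(1) by (auto simp: r_def min_def)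
  define q where "q = (\<lambda>x. sqdist m x z)"
  have q: "continuous_map (nsphere m) euclideanreal q"
    unfolding q_def sqdist_def by (intro continuous_intros continuous_map_nsphere_projection) auto
  \<comment> \<open>The cutoff \<open>u\<close> is 1 up to squared distance \<open>r\<close> and 0
    from \<open>2 * r\<close> on; the bump \<open>w\<close> vanishes from \<open>r / 2\<close> on.
    The shell between \<open>r / 2\<close> and \<open>r\<close>, where \<open>u\<close> is 1 and
    \<open>w\<close> is 0, makes the two open sets used below overlap.\<close>
  define u where "u = (\<lambda>x. min 1 (max 0 (2 - q x / r)))"
  define w where "w = (\<lambda>x. min 1 (max 0 (1 - 2 * q x / r)))"
  define \<psi> where "\<psi> = (\<lambda>x. (1 - u x) * \<phi> x + u x * a)"
  define \<theta> where "\<theta> = (\<lambda>x. \<psi> x + (b - a) * w x)"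
  have cu: "continuous_map (nsphere m) euclideanreal u" "continuous_map (nsphere m) euclideanreal w"
    unfolding u_def w_def using r(1) by (intro continuous_intros q; simp)+
  have c\<psi>: "continuous_map (nsphere m) euclideanreal \<psi>"
    unfolding \<psi>_def by (intro continuous_intros cu \<phi>) auto
  have c\<theta>: "continuous_map (nsphere m) euclideanreal \<theta>"
    unfolding \<theta>_def by (intro continuous_intros cu c\<psi>) auto
  have u01: "0 \<le> u x" "u x \<le> 1" "0 \<le> w x" "w x \<le> 1" for x by (auto simp: u_def w_def)
  have u1: "u x = 1" if "q x \<le> r" for x using that r(1) by (simp add: u_def field_simps)
  have u0: "u x = 0" if "2 * r \<le> q x" for x using that r(1) by (simp add: u_def field_simps)
  have w0: "w x = 0" if "r / 2 \<le> q x" for x using that r(1) by (simp add: w_def field_simps)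
  have qz: "q z = 0" by (simp add: q_def)
  have wz: "w z = 1" by (simp add: w_def qz)
  have "q (\<lambda>i. - z i) = (\<Sum>i\<le>m. 4 * (z i)\<^sup>2)"
    unfolding q_def sqdist_def by (intro sum.cong) (auto simp: power2_eq_square)
  also have "\<dots> = 4" using z by (simp add: topspace_nsphere flip: sum_distrib_left)
  finally have wmz: "w (\<lambda>i. - z i) = 0" using r by (intro w0) simp
  have \<psi>01: "0 \<le> \<psi> x \<and> \<psi> x \<le> 1" if "x \<in> ?S" for x
  proof -
    have "a \<le> 1" using ab by simp
    then have "(1 - u x) * \<phi> x + u x * a \<le> 1"
      using \<phi>(2)[OF that] u01[of x] by (intro convex_bound_le) simp_all
    then show ?thesis
      using \<phi>(2)[OF that] u01[of x] ab(1) by (simp add: \<psi>_def)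
  qed
  have \<theta>in: "\<theta> x = a + (b - a) * w x" if "q x \<le> r" for x using u1[OF that] by (simp add: \<theta>_def \<psi>_def)
  have \<theta>out: "\<theta> x = \<psi> x" if "r / 2 \<le> q x" for x using w0[OF that] by (simp add: \<theta>_def)
  have \<psi>out: "\<psi> x = \<phi> x" if "\<rho> \<le> q x" for x using u0[of x] r that by (simp add: \<psi>_def)
  have abw: "a \<le> a + (b - a) * w x" "a + (b - a) * w x \<le> b" for x
  proof -
    have "0 \<le> (b - a) * w x" "(b - a) * w x \<le> b - a" using u01 ab by (auto intro: mult_left_le)
    then show "a \<le> a + (b - a) * w x" "a + (b - a) * w x \<le> b" by linarith+
  qed
  have \<theta>01: "0 \<le> \<theta> x \<and> \<theta> x \<le> 1" if "x \<in> ?S" for x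
  proof (cases "q x \<le> r")
    case True
    then show ?thesis using abw[of x] ab by (simp add: \<theta>in)
  next
    case False
    then show ?thesis using \<psi>01[OF that] r by (simp add: \<theta>out)
  qed
  have \<psi>z: "\<psi> z = a" and \<theta>z: "\<theta> z = b"
    using u1[of z] r(1) by (simp_all add: \<psi>_def \<theta>_def qz wz)
  \<comment> \<open>Inside \<open>\<rho>\<close> the only crossing is at \<open>z\<close> at time
    \<open>s0\<close>, and outside \<open>\<rho>\<close> the old profile is kept; so a new profile
    is safe as soon as its value at \<open>z\<close> is not \<open>s0\<close>.\<close>
  have nc: "\<not> crossing m C (f x) x"
    if "x \<in> ?S" "0 \<le> f x \<and> f x \<le> 1" "f z \<noteq> s0" "\<rho> \<le> q x \<Longrightarrow> f x = \<phi> x" for f :: "(nat \<Rightarrow> real) \<Rightarrow> real" and x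
  proof (cases "q x < \<rho>")
    case True
    show ?thesis
    proof
      assume "crossing m C (f x) x"
      then have "x = z \<and> f x = s0"
        using \<rho>(2)[of "f x" x] that(1,2) True unfolding q_def by blast
      then show False using that(3) by blast
    qed
  next
    case False
    then have "x \<noteq> z" using qz \<rho>(1) by auto
    then show ?thesis using off[OF that(1)] that(4) False by simp
  qed
  have \<theta>\<phi>: "\<theta> x = \<phi> x" if "\<rho> \<le> q x" for x using that r \<theta>out[of x] \<psi>out[of x] by simp
  have fC: "field_on_sphere m (pencil_field C \<theta>)" "field_on_sphere m (pencil_field C \<psi>)"
  proof -
    have "\<not> crossing m C (\<theta> x) x" "\<not> crossing m C (\<psi> x) x" if "x \<in> ?S" for x
      using nc[of x \<theta>] nc[of x \<psi>] \<theta>01[OF that] \<psi>01[OF that] \<theta>\<phi>[of x] \<psi>out[of x] \<theta>z \<psi>z ab that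
      by simp_all
    then show "field_on_sphere m (pencil_field C \<theta>)" "field_on_sphere m (pencil_field C \<psi>)"
      by (auto intro: field_on_sphere_pencil[OF C] c\<theta> c\<psi>)
  qed
  have fD: "field_on_sphere m (pencil_field D (\<lambda>x. a + (b - a) * w x))" "field_on_sphere m (pencil_field D (\<lambda>x. a))"
  proof -
    have "\<not> crossing m D (a + (b - a) * w x) x" if "x \<in> ?S" for x
    proof
      assume "crossing m D (a + (b - a) * w x) x"
      then have "a + (b - a) * w x = s0" "x = z \<or> x = (\<lambda>i. - z i)"
        using only[OF abw that] by auto
      then show False using wz wmz ab by auto
    qed
    then show "field_on_sphere m (pencil_field D (\<lambda>x. a + (b - a) * w x))"
      by (intro field_on_sphere_pencil D continuous_intros cu) auto
    have "\<not> crossing m D a x" if "x \<in> ?S" for x using only[of a x] that ab by auto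
    then show "field_on_sphere m (pencil_field D (\<lambda>x. a))"
      by (intro field_on_sphere_pencil D) auto
  qed
  have "field_degree m (pencil_field C \<phi>) = field_degree m (pencil_field C \<theta>)"
  proof (rule field_degree_pencil_homotopy[OF C \<phi>(1) c\<theta>])
    fix x s assume x: "x \<in> ?S" and s: "s \<in> closed_segment (\<phi> x) (\<theta> x)"
    have "closed_segment (\<phi> x) (\<theta> x) \<subseteq> {0..1}"
      using \<phi>(2)[OF x] \<theta>01[OF x] by (intro closed_segment_subset) auto
    then have s01: "0 \<le> s" "s \<le> 1" using s by auto
    show "\<not> crossing m C s x"
    proof
      assume cr: "crossing m C s x"
      show False
      proof (cases "q x < \<rho>")
        case True
        then have "x = z" "s = s0" using \<rho>(2)[OF s01 x cr] by (auto simp: q_def)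
        moreover have "closed_segment (\<phi> z) (\<theta> z) \<subseteq> {s0<..}"
          using above ab \<theta>z by (intro closed_segment_subset) auto
        ultimately show False using s by auto
      next
        case False
        then have "\<theta> x = \<phi> x" by (simp add: \<theta>\<phi>)
        moreover have "x \<noteq> z" using False qz \<rho>(1) by auto
        ultimately show False using s off[OF x] cr by simp
      qed
    qed
  qed
  \<comment> \<open>Near \<open>z\<close> both profiles coincide with those of the model and
    \<open>C\<close> with \<open>D\<close>; away from \<open>z\<close> there is no bump and nothing
    changes on either side.\<close>
  moreover have "field_degree m (pencil_field C \<theta>) - field_degree m (pencil_field C \<psi>)
     = field_degree m (pencil_field D (\<lambda>x. a + (b - a) * w x)) - field_degree m (pencil_field D (\<lambda>x. a))"
  proof (rule field_degree_additive_cover[OF fC fD])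
    show "openin (nsphere m) {x \<in> ?S. q x \<in> {..<r}}" "openin (nsphere m) {x \<in> ?S. q x \<in> {r/2<..}}"
      by (intro openin_continuous_map_preimage[OF q]; simp)+
    show "?S \<subseteq> {x \<in> ?S. q x \<in> {..<r}} \<union> {x \<in> ?S. q x \<in> {r/2<..}}" using r by auto
    show "pencil_field C \<theta> x i = pencil_field D (\<lambda>x. a + (b - a) * w x) x i \<and>
        pencil_field C \<psi> x i = pencil_field D (\<lambda>x. a) x i" if "x \<in> {x \<in> ?S. q x \<in> {..<r}}" "i \<le> m" for x i
      using that \<theta>in[of x] u1[of x] CD[of x i] r by (auto simp: pencil_field_def \<psi>_def q_def)
    show "pencil_field C \<theta> x i = pencil_field C \<psi> x i \<and> pencil_field D (\<lambda>x. a + (b - a) * w x) x i =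
        pencil_field D (\<lambda>x. a) x i" if "x \<in> {x \<in> ?S. q x \<in> {r/2<..}}" "i \<le> m" for x i
      using that \<theta>out[of x] w0[of x] by (auto simp: pencil_field_def)
  qed
  moreover have "2 * (field_degree m (pencil_field D (\<lambda>x. a + (b - a) * w x))
      - field_degree m (pencil_field D (\<lambda>x. a))) = 2 * \<kappa>"
    unfolding \<kappa>
    by (rule odd_crossing_half_jump[OF _ _ z ab(2,3) _ cu(2) _ wz wmz]) (fact D odd only | simp add: u01)+
  ultimately have "field_degree m (pencil_field C \<phi>) = field_degree m (pencil_field C \<psi>) + \<kappa>"
    by simp
  then show ?thesis
    using c\<psi> \<psi>01 \<psi>z ab(2) \<psi>out unfolding q_def by (intro exI[of _ \<psi>]) simp
qed

text \<open>The claim is generalised from the profile 1 to any profile avoiding the crossings, with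
  \<open>J\<close> the set of crossings below it; the induction removes one element of
  \<open>J\<close> at a time.\<close>

theorem field_degree_pencil_sum:
  fixes zp :: "'i \<Rightarrow> nat \<Rightarrow> real" and \<kappa> :: "'i \<Rightarrow> int"
  assumes C: "\<And>i. i \<le> m \<Longrightarrow> continuous_map (nsphere m) euclideanreal (\<lambda>x. C x i)"
    and I: "finite I" "inj_on zp I"
    and zp: "\<And>i. i \<in> I \<Longrightarrow> zp i \<in> topspace (nsphere m)"
    and sv: "\<And>i. i \<in> I \<Longrightarrow> 0 < sv i \<and> sv i < 1"
    and zeros: "\<And>s x. \<lbrakk>0 \<le> s; s \<le> 1; x \<in> topspace (nsphere m); crossing m C s x\<rbrakk>
        \<Longrightarrow> \<exists>i\<in>I. x = zp i \<and> s = sv i"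
    and model: "\<And>i. i \<in> I \<Longrightarrow> odd_model m C (zp i) (sv i) (\<kappa> i)"
  shows "field_degree m (pencil_field C (\<lambda>x. 1)) = 1 + (\<Sum>i\<in>I. \<kappa> i)"
proof -
  let ?S = "topspace (nsphere m)"
  have main: "field_degree m (pencil_field C \<phi>) = 1 + (\<Sum>i\<in>J. \<kappa> i)"
    if "finite J" "J \<subseteq> I" "continuous_map (nsphere m) euclideanreal \<phi>"
      "\<And>x. x \<in> ?S \<Longrightarrow> 0 \<le> \<phi> x \<and> \<phi> x \<le> 1"
      "\<And>i. i \<in> J \<Longrightarrow> sv i < \<phi> (zp i)" "\<And>i. i \<in> I - J \<Longrightarrow> \<phi> (zp i) < sv i" for J \<phi>
    using that
  proof (induction J arbitrary: \<phi> rule: finite_induct)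
    case empty
    \<comment> \<open>Every crossing lies above the profile, which can therefore sink to 0, where
      the pencil is the identity.\<close>
    have "field_degree m (pencil_field C \<phi>) = field_degree m (pencil_field C (\<lambda>x. 0))"
    proof (rule field_degree_pencil_homotopy[OF C empty(2)])
      fix x s assume x: "x \<in> ?S" and s: "s \<in> closed_segment (\<phi> x) 0"
      then have "0 \<le> s" "s \<le> \<phi> x" "\<phi> x \<le> 1"
        using empty(3)[OF x] by (auto simp: closed_segment_eq_real_ivl split: if_splits)
      then show "\<not> crossing m C s x" using zeros[of s x] x empty(5) by fastforce
    qed auto
    also have "pencil_field C (\<lambda>x. 0) = (\<lambda>x. x)"
      by (simp add: pencil_field_def[abs_def])
    finally show ?case by (simp add: field_degree_id)
  next
    case (insert i J)
    have i: "i \<in> I" using insert by simp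
    \<comment> \<open>The distance to the other crossings, so that lowering the profile at
      \<open>zp i\<close> keeps its values at those. The element 1 makes the minimum meaningful when
      \<open>i\<close> is the only index.\<close>
    define \<rho> where "\<rho> = Min (insert 1 ((\<lambda>j. sqdist m (zp j) (zp i)) ` (I - {i})))"
    have \<rho>0: "0 < \<rho>"
      unfolding \<rho>_def using I i zp by (subst Min_gr_iff) (auto intro!: sqdist_pos dest: inj_onD)
    have \<rho>le: "\<rho> \<le> sqdist m (zp j) (zp i)" if "j \<in> I" "j \<noteq> i" for j
      unfolding \<rho>_def using I that by (intro Min_le) auto
    have near: "x = zp i \<and> s = sv i"
      if "0 \<le> s" "s \<le> 1" "x \<in> ?S" "crossing m C s x" "sqdist m x (zp i) < \<rho>" for s x
      using zeros[OF that(1-4)] \<rho>le that(5) by fastforce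
    have off: "\<not> crossing m C (\<phi> x) x" if x: "x \<in> ?S" "x \<noteq> zp i" for x
    proof
      assume "crossing m C (\<phi> x) x"
      then obtain j where "j \<in> I" "x = zp j" "\<phi> x = sv j"
        using zeros[of "\<phi> x" x] insert.prems(3)[OF x(1)] x(1) by blast
      then show False using insert.prems(4)[of j] insert.prems(5)[of j] by auto
    qed
    have above: "sv i < \<phi> (zp i)" using insert.prems by simp
    obtain \<psi> where \<psi>: "continuous_map (nsphere m) euclideanreal \<psi>"
      "\<forall>x\<in>?S. 0 \<le> \<psi> x \<and> \<psi> x \<le> 1" "\<psi> (zp i) < sv i"
      "\<forall>x. \<rho> \<le> sqdist m x (zp i) \<longrightarrow> \<psi> x = \<phi> x"
      "field_degree m (pencil_field C \<phi>) = field_degree m (pencil_field C \<psi>) + \<kappa> i"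
    proof -
      have "\<exists>\<psi>. continuous_map (nsphere m) euclideanreal \<psi> \<and>
        (\<forall>x\<in>?S. 0 \<le> \<psi> x \<and> \<psi> x \<le> 1) \<and> \<psi> (zp i) < sv i \<and>
        (\<forall>x. \<rho> \<le> sqdist m x (zp i) \<longrightarrow> \<psi> x = \<phi> x) \<and>
        field_degree m (pencil_field C \<phi>) = field_degree m (pencil_field C \<psi>) + \<kappa> i"
        by (rule push_through_crossing[OF _ zp[OF i] model[OF i] insert.prems(2) _ \<rho>0 _ _ above])
          (fact C insert.prems(3) near off)+
      then show thesis using that by (elim exE conjE)
    qed
    have "field_degree m (pencil_field C \<psi>) = 1 + (\<Sum>i\<in>J. \<kappa> i)"
    proof (rule insert.IH)
      show "sv j < \<psi> (zp j)" if "j \<in> J" for j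
        using that insert.prems(1) insert.prems(4)[of j] insert.hyps(2) \<rho>le[of j] \<psi>(4)[rule_format, of "zp j"]
        by (cases "j = i") auto
      show "\<psi> (zp j) < sv j" if "j \<in> I - J" for j
        using that insert.prems(5)[of j] \<psi>(3) \<rho>le[of j] \<psi>(4)[rule_format, of "zp j"] by (cases "j = i") auto
    qed (use insert.prems(1) \<psi>(1,2) in simp_all)
    then show ?case using \<psi>(5) insert.hyps by simp
  qed
  show ?thesis
    by (rule main[OF I(1)]) (use sv in auto)
qed

subsection \<open>Aligned trios\<close>

lemma sign_mats_square:
  assumes "S \<in> sign_mats n" shows "S * S = 1\<^sub>m n"
proof (rule eq_matI)
  have S: "S \<in> carrier_mat n n" using assms by (simp add: sign_mats_def)
  fix i j assume ij: "i < dim_row (1\<^sub>m n :: real mat)" "j < dim_col (1\<^sub>m n :: real mat)"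
  have "(S * S) $$ (i, j) = (\<Sum>k\<in>{0..<n}. S $$ (i, k) * S $$ (k, j))"
    using S ij by (simp add: scalar_prod_def)
  also have "\<dots> = (\<Sum>k\<in>{0..<n}. if k = i then S $$ (i, i) * S $$ (i, j) else 0)"
    using assms ij by (intro sum.cong) (auto simp: sign_mats_def diagonal_mat_def)
  also have "\<dots> = S $$ (i, i) * S $$ (i, j)" using ij by simp
  also have "\<dots> = 1\<^sub>m n $$ (i, j)"
    using assms ij by (auto simp: sign_mats_def diagonal_mat_def)
  finally show "(S * S) $$ (i, j) = 1\<^sub>m n $$ (i, j)" .
qed (use assms in \<open>auto simp: sign_mats_def\<close>)

lemma sign_mats_mult_vec_index:
  assumes S: "S \<in> sign_mats n" and v: "v \<in> carrier_vec n" and i: "i < n"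
  shows "(S *\<^sub>v v) $ i = S $$ (i, i) * v $ i"
proof -
  have "(S *\<^sub>v v) $ i = (\<Sum>k\<in>{0..<n}. S $$ (i, k) * v $ k)"
    using assms by (auto simp: sign_mats_def scalar_prod_def)
  also have "\<dots> = (\<Sum>k\<in>{0..<n}. if k = i then S $$ (i, i) * v $ i else 0)"
    using assms by (intro sum.cong) (auto simp: sign_mats_def diagonal_mat_def)
  finally show ?thesis using i by simp
qed

lemma sign_mats_abs_diag: "\<lbrakk>S \<in> sign_mats n; i < n\<rbrakk> \<Longrightarrow> \<bar>S $$ (i, i)\<bar> = 1"
  by (auto simp: sign_mats_def)

lemma sign_mats_mult_mult_vec:
  assumes "S \<in> sign_mats n" "v \<in> carrier_vec n"
  shows "S *\<^sub>v (S *\<^sub>v v) = v"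
proof -
  have "S \<in> carrier_mat n n" using assms by (simp add: sign_mats_def)
  then have "S *\<^sub>v (S *\<^sub>v v) = (S * S) *\<^sub>v v" using assms by simp
  then show ?thesis using assms by (simp add: sign_mats_square)
qed

lemma finite_sign_mats: "finite (sign_mats n)"
proof -
  have "sign_mats n \<subseteq> (\<lambda>f. Matrix.mat n n (\<lambda>(i, j). if i = j then f i else 0)) ` ({..<n} \<rightarrow>\<^sub>E {-1, 1})"
  proof
    fix S assume S: "S \<in> sign_mats n"
    have "S = Matrix.mat n n (\<lambda>(i, j). if i = j then (\<lambda>i\<in>{..<n}. S $$ (i, i)) i else 0)"
      using S by (intro eq_matI) (auto simp: sign_mats_def diagonal_mat_def)
    moreover have "(\<lambda>i\<in>{..<n}. S $$ (i, i)) \<in> {..<n} \<rightarrow>\<^sub>E {-1, 1}"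
      using S by (auto simp: sign_mats_def)
    ultimately show "S \<in> (\<lambda>f. Matrix.mat n n (\<lambda>(i, j). if i = j then f i else 0)) ` ({..<n} \<rightarrow>\<^sub>E {-1, 1})"
      by blast
  qed
  then show ?thesis by (rule finite_subset) (auto intro!: finite_PiE)
qed

text \<open>Zero coordinates receive the sign 1; either sign would do, since it multiplies a
  vanishing absolute value.\<close>

definition sign_mat :: "nat \<Rightarrow> real vec \<Rightarrow> real mat" where
  "sign_mat n z = Matrix.mat n n (\<lambda>(i, j). if i = j then (if z $ i \<ge> 0 then 1 else -1) else 0)"

lemma sign_mat_in: "sign_mat n z \<in> sign_mats n"
  by (auto simp: sign_mat_def sign_mats_def diagonal_mat_def)

lemma sign_mat_mult_abs:
  assumes "z \<in> carrier_vec n" shows "sign_mat n z *\<^sub>v map_vec abs z = z"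
proof (rule eq_vecI)
  fix i assume "i < dim_vec z"
  then show "(sign_mat n z *\<^sub>v map_vec abs z) $ i = z $ i"
    using assms by (subst sign_mats_mult_vec_index[OF sign_mat_in]) (auto simp: sign_mat_def)
qed (use assms in \<open>auto simp: sign_mat_def\<close>)

lemma scalar_prod_self_eq: "v \<bullet> v = (\<Sum>i<dim_vec v. (v $ i)\<^sup>2)" for v :: "real vec"
  by (simp add: scalar_prod_def atLeast0LessThan power2_eq_square)

lemma nonneg_unit_vecs_iff:
  "v \<in> nonneg_unit_vecs n \<longleftrightarrow> v \<in> carrier_vec n \<and> (\<forall>i<n. 0 \<le> v $ i) \<and> (\<Sum>i<n. (v $ i)\<^sup>2) = 1"
  by (auto simp: nonneg_unit_vecs_def less_eq_vec_def l2_norm_vec_def scalar_prod_self_eq)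

lemma scale_in_nonneg_unit_vecs:
  fixes y :: "real vec"
  assumes y: "y \<in> carrier_vec n" "\<forall>i<n. 0 \<le> y $ i" "y \<noteq> 0\<^sub>v n"
  shows "\<exists>c>0. c \<cdot>\<^sub>v y \<in> nonneg_unit_vecs n"
proof -
  let ?q = "\<Sum>i<n. (y $ i)\<^sup>2"
  obtain k where k: "k < n" "y $ k \<noteq> 0"
    using y by (metis carrier_vecD dim_vec eq_vecI index_zero_vec(1) index_zero_vec(2))
  have "(y $ k)\<^sup>2 \<le> ?q" using k by (intro member_le_sum) auto
  then have q: "0 < ?q" using k by (smt (verit) zero_less_power2)
  have "(\<Sum>i<n. ((inverse (sqrt ?q) \<cdot>\<^sub>v y) $ i)\<^sup>2) = (inverse (sqrt ?q))\<^sup>2 * ?q"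
    using y by (simp add: power_mult_distrib sum_distrib_left)
  also have "\<dots> = 1" using q by (simp add: power_inverse)
  finally show ?thesis
    using y q by (intro exI[of _ "inverse (sqrt ?q)"]) (simp add: nonneg_unit_vecs_iff)
qed

section \<open>Consequences of genericity\<close>

text \<open>The premise of \<open>generic_mat\<close>; for the matrix \<open>A\<close> of the
  overview these are exactly the LCP-aligned trios of \<open>M\<close>.\<close>

definition eig_trio :: "nat \<Rightarrow> real mat \<Rightarrow> real \<Rightarrow> real mat \<Rightarrow> real vec \<Rightarrow> bool" where
  "eig_trio n A l S v \<longleftrightarrow>
     l \<ge> 0 \<and> S \<in> sign_mats n \<and> v \<in> nonneg_unit_vecs n \<and> (S * A) *\<^sub>v v = l \<cdot>\<^sub>v v"

lemma generic_mat_trio: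
  fixes v :: "real vec"
  assumes "generic_mat n A" "eig_trio n A l S v"
  shows "simple_eigenvalue (S * A) l" "\<forall>i<n. 0 < v $ i"
  using assms unfolding generic_mat_def eig_trio_def by blast+

text \<open>Otherwise, subtracting the largest admissible multiple of \<open>v\<close> from \<open>u\<close> would give an
  aligned vector with a vanishing coordinate.\<close>

lemma generic_mat_eigenspace:
  assumes A: "A \<in> carrier_mat n n" and gen: "generic_mat n A" and trio: "eig_trio n A l S v"
    and n: "0 < n"
    and u: "u \<in> carrier_vec n" "(S * A) *\<^sub>v u = l \<cdot>\<^sub>v u"
  shows "\<exists>c. u = c \<cdot>\<^sub>v v"
proof -
  have S: "S \<in> sign_mats n" "S * A \<in> carrier_mat n n" and v: "v \<in> carrier_vec n"
    and l: "l \<ge> 0" and ev: "(S * A) *\<^sub>v v = l \<cdot>\<^sub>v v"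
    using trio A by (auto simp: eig_trio_def nonneg_unit_vecs_iff sign_mats_def)
  have vpos: "0 < v $ i" if "i < n" for i using generic_mat_trio(2)[OF gen trio] that by blast
  let ?Q = "(\<lambda>i. u $ i / v $ i) ` {..<n}"
  define c where "c = Min ?Q"
  define y where "y = u - c \<cdot>\<^sub>v v"
  have "?Q \<noteq> {}" using n by auto
  then have "c \<in> ?Q" unfolding c_def by (intro Min_in) auto
  then obtain k where k: "k < n" "c = u $ k / v $ k" by auto
  have y: "y \<in> carrier_vec n" using u v by (simp add: y_def)
  have yi: "y $ i = u $ i - c * v $ i" if "i < n" for i using u v that by (simp add: y_def)
  have ynn: "\<forall>i<n. 0 \<le> y $ i"
  proof (intro allI impI)
    fix i assume i: "i < n"
    have "c \<le> u $ i / v $ i" unfolding c_def using i by (intro Min_le) auto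
    then show "0 \<le> y $ i" using vpos[OF i] i by (simp add: yi pos_le_divide_eq)
  qed
  have yk: "y $ k = 0" using k vpos[OF k(1)] by (simp add: yi)
  have ye: "(S * A) *\<^sub>v y = l \<cdot>\<^sub>v y"
  proof -
    have "(S * A) *\<^sub>v y = (S * A) *\<^sub>v u - c \<cdot>\<^sub>v ((S * A) *\<^sub>v v)"
      unfolding y_def using S u v by (simp add: mult_minus_distrib_mat_vec mult_mat_vec)
    also have "\<dots> = l \<cdot>\<^sub>v y"
      unfolding u ev y_def using u v by (intro eq_vecI) (auto simp: algebra_simps)
    finally show ?thesis .
  qed
  have "y = 0\<^sub>v n"
  proof (rule ccontr)
    assume "y \<noteq> 0\<^sub>v n"
    then obtain d where d: "0 < d" "d \<cdot>\<^sub>v y \<in> nonneg_unit_vecs n"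
      using scale_in_nonneg_unit_vecs[OF y ynn] by blast
    have "(S * A) *\<^sub>v (d \<cdot>\<^sub>v y) = l \<cdot>\<^sub>v (d \<cdot>\<^sub>v y)"
      using S y ye by (simp add: mult_mat_vec smult_smult_assoc mult.commute)
    then have "eig_trio n A l S (d \<cdot>\<^sub>v y)" using d l S by (simp add: eig_trio_def)
    from generic_mat_trio(2)[OF gen this] show False using k(1) y yk by auto
  qed
  then have "u = c \<cdot>\<^sub>v v"
    using u v yi by (intro eq_vecI) auto
  then show ?thesis by blast
qed

text \<open>This converts the time \<open>s\<close> into the spectral variable \<open>1 / s\<close>;
  for positive \<open>s\<close> the power of \<open>s\<close> does not affect signs.\<close>

lemma det_one_minus_smult:
  fixes B :: "real mat"
  assumes B: "B \<in> carrier_mat n n" and s: "s \<noteq> 0"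
  shows "Determinant.det (1\<^sub>m n - s \<cdot>\<^sub>m B) = s ^ n * poly (char_poly B) (1 / s)"
proof -
  have "1\<^sub>m n - s \<cdot>\<^sub>m B = s \<cdot>\<^sub>m (- (char_matrix B (1 / s)))"
    using B s by (intro eq_matI) (auto simp: char_matrix_def field_simps)
  moreover have "dim_col (char_matrix B (1 / s)) = n" using B by (simp add: char_matrix_def)
  ultimately show ?thesis using B by (simp add: char_poly_matrix)
qed

text \<open>Write \<open>p\<close> as the product of \<open>t - l\<close> and \<open>q\<close>: the
  value of \<open>q\<close> at \<open>l\<close> is the derivative of \<open>p\<close> there, and by
  continuity \<open>q\<close> keeps its sign nearby.\<close>

lemma simple_root_sgn:
  fixes p :: "real poly"
  assumes p: "p \<noteq> 0" and ord: "Polynomial.order l p = 1"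
  shows "poly (pderiv p) l \<noteq> 0"
    "\<exists>d>0. \<forall>t. \<bar>t - l\<bar> \<le> d \<longrightarrow> sgn (poly p t) = sgn (t - l) * sgn (poly (pderiv p) l)"
proof -
  obtain q where q: "p = [:- l, 1:] * q" "\<not> [:- l, 1:] dvd q"
    using order_decomp[OF p, of l] ord by auto
  have ql: "poly q l \<noteq> 0" using q(2) by (simp add: poly_eq_0_iff_dvd)
  have pd: "poly (pderiv p) l = poly q l"
    unfolding q(1) by (simp only: pderiv_mult) (simp add: pderiv_pCons)
  show "poly (pderiv p) l \<noteq> 0" using ql pd by simp
  have "((\<lambda>t. poly q t * poly q l) \<longlongrightarrow> poly q l * poly q l) (at l)"
    by (intro tendsto_intros)
  moreover have "0 < poly q l * poly q l" using ql not_real_square_gt_zero by blast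
  ultimately have "\<forall>\<^sub>F t in at l. 0 < poly q t * poly q l" by (rule order_tendstoD)
  then obtain d where d: "0 < d" "\<And>t. t \<noteq> l \<Longrightarrow> dist t l < d \<Longrightarrow> 0 < poly q t * poly q l"
    by (auto simp: eventually_at)
  have "sgn (poly p t) = sgn (t - l) * sgn (poly (pderiv p) l)" if t: "\<bar>t - l\<bar> \<le> d / 2" for t
  proof (cases "t = l")
    case False
    then have "0 < poly q t * poly q l" using t d by (intro d(2)) (auto simp: dist_real_def)
    then have "sgn (poly q t) = sgn (poly q l)" by (auto simp: zero_less_mult_iff)
    moreover have "poly p t = (t - l) * poly q t" by (simp add: q(1) algebra_simps)
    ultimately show ?thesis by (simp add: pd sgn_mult)
  qed (simp add: q(1))
  then show "\<exists>d>0. \<forall>t. \<bar>t - l\<bar> \<le> d \<longrightarrow> sgn (poly p t) = sgn (t - l) * sgn (poly (pderiv p) l)"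
    using d(1) by (intro exI[of _ "d / 2"]) auto
qed

lemma pencil_field_mat_const:
  assumes "B \<in> carrier_mat (Suc m) (Suc m)" "i \<le> m"
  shows "pencil_field (mat_field B) (\<lambda>x. s) x i = mat_field (1\<^sub>m (Suc m) - s \<cdot>\<^sub>m B) x i"
proof -
  have "mat_field (1\<^sub>m (Suc m) - s \<cdot>\<^sub>m B) x i
      = (\<Sum>j<Suc m. (if j = i then x i else 0) - s * (B $$ (i, j) * x j))"
    unfolding mat_field_def using assms by (intro sum.cong) (auto simp: algebra_simps)
  also have "\<dots> = x i - s * mat_field B x i"
    using assms by (simp add: mat_field_def sum_subtractf sum_distrib_left del: sum.lessThan_Suc)
  finally show ?thesis by (simp add: pencil_field_def)
qed

lemma field_degree_pencil_mat_const:
  assumes B: "B \<in> carrier_mat (Suc m) (Suc m)" and s: "0 < s" and p: "poly (char_poly B) (1 / s) \<noteq> 0"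
  shows "real_of_int (field_degree m (pencil_field (mat_field B) (\<lambda>x. s))) = sgn (poly (char_poly B) (1 / s))"
proof -
  have det: "Determinant.det (1\<^sub>m (Suc m) - s \<cdot>\<^sub>m B) = s ^ Suc m * poly (char_poly B) (1 / s)"
    using B s by (intro det_one_minus_smult) auto
  have "field_degree m (pencil_field (mat_field B) (\<lambda>x. s)) = field_degree m (mat_field (1\<^sub>m (Suc m) - s \<cdot>\<^sub>m B))"
    using B by (intro field_degree_cong pencil_field_mat_const)
  also have "real_of_int \<dots> = sgn (Determinant.det (1\<^sub>m (Suc m) - s \<cdot>\<^sub>m B))"
    using B s p det by (intro field_degree_mat_field) auto
  finally show ?thesis using s by (simp add: det sgn_mult)
qed

section \<open>Crossings of the pencil with absolute values\<close>

definition vec_fun :: "real vec \<Rightarrow> nat \<Rightarrow> real" where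
  "vec_fun v i = (if i < dim_vec v then v $ i else 0)"

lemma vec_fun_vec: "x \<in> topspace (nsphere m) \<Longrightarrow> vec_fun (Matrix.vec (Suc m) x) = x"
  by (auto simp: vec_fun_def topspace_nsphere fun_eq_iff)

lemma vec_fun_in_nsphere:
  "v \<in> carrier_vec (Suc m) \<Longrightarrow> vec_fun v \<in> topspace (nsphere m) \<longleftrightarrow> (\<Sum>i<Suc m. (v $ i)\<^sup>2) = 1"
  by (simp add: topspace_nsphere vec_fun_def lessThan_Suc_atMost)

lemma crossing_mat_field_iff:
  assumes B: "B \<in> carrier_mat (Suc m) (Suc m)"
  shows "crossing m (mat_field B) s x \<longleftrightarrow> Matrix.vec (Suc m) x = s \<cdot>\<^sub>v (B *\<^sub>v Matrix.vec (Suc m) x)"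
proof -
  have "crossing m (mat_field B) s x \<longleftrightarrow> (\<forall>i<Suc m. Matrix.vec (Suc m) x $ i = (s \<cdot>\<^sub>v (B *\<^sub>v Matrix.vec (Suc m) x)) $ i)"
    unfolding crossing_def using B by (auto simp: mat_field_eq_mult_vec[OF B] less_Suc_eq_le)
  also have "\<dots> \<longleftrightarrow> Matrix.vec (Suc m) x = s \<cdot>\<^sub>v (B *\<^sub>v Matrix.vec (Suc m) x)"
  proof
    assume *: "\<forall>i<Suc m. Matrix.vec (Suc m) x $ i = (s \<cdot>\<^sub>v (B *\<^sub>v Matrix.vec (Suc m) x)) $ i"
    show "Matrix.vec (Suc m) x = s \<cdot>\<^sub>v (B *\<^sub>v Matrix.vec (Suc m) x)"
      by (rule eq_vecI) (use * B in simp_all)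
  next
    assume *: "Matrix.vec (Suc m) x = s \<cdot>\<^sub>v (B *\<^sub>v Matrix.vec (Suc m) x)"
    show "\<forall>i<Suc m. Matrix.vec (Suc m) x $ i = (s \<cdot>\<^sub>v (B *\<^sub>v Matrix.vec (Suc m) x)) $ i"
      by (intro allI impI, rule arg_cong[OF *])
  qed
  finally show ?thesis .
qed

definition abs_field :: "real mat \<Rightarrow> (nat \<Rightarrow> real) \<Rightarrow> nat \<Rightarrow> real" where
  "abs_field A x i = mat_field A (\<lambda>j. \<bar>x j\<bar>) i"

lemma continuous_map_abs_field: "continuous_map (nsphere m) euclideanreal (\<lambda>x. abs_field A x i)"
  unfolding abs_field_def mat_field_def
  by (intro continuous_intros continuous_map_nsphere_projection) auto

lemma map_vec_abs_vec: "map_vec abs (Matrix.vec n x) = Matrix.vec n (\<lambda>j. \<bar>x j\<bar>)"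
  by (intro eq_vecI) auto

lemma abs_field_eq_mult_vec:
  assumes "A \<in> carrier_mat n n" "i < n"
  shows "abs_field A x i = (A *\<^sub>v map_vec abs (Matrix.vec n x)) $ i"
  using assms by (simp add: abs_field_def mat_field_eq_mult_vec[OF assms] map_vec_abs_vec)

text \<open>Since \<open>z\<close> is its sign matrix applied to its absolute value, and the sign
  matrix is an involution, multiplying the fixed-point equation by it leaves only the absolute value
  of \<open>z\<close>.\<close>

lemma abs_fixed_eigenvector:
  assumes A: "A \<in> carrier_mat n n" and z: "z \<in> carrier_vec n" and s: "0 < s"
    and fixed: "z = s \<cdot>\<^sub>v (A *\<^sub>v map_vec abs z)"
  shows "(sign_mat n z * A) *\<^sub>v map_vec abs z = (1 / s) \<cdot>\<^sub>v map_vec abs z"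
proof -
  let ?S = "sign_mat n z" and ?v = "map_vec abs z"
  have S: "?S \<in> carrier_mat n n" by (simp add: sign_mat_def)
  have v: "?v \<in> carrier_vec n" using z by simp
  have "(1 / s) \<cdot>\<^sub>v z = (1 / s) \<cdot>\<^sub>v (s \<cdot>\<^sub>v (A *\<^sub>v ?v))"
    by (rule arg_cong[OF fixed])
  also have "\<dots> = A *\<^sub>v ?v" using s by (simp add: smult_smult_assoc)
  finally have Av: "A *\<^sub>v ?v = (1 / s) \<cdot>\<^sub>v z" by simp
  have "?S *\<^sub>v z = ?S *\<^sub>v (?S *\<^sub>v ?v)" by (simp add: sign_mat_mult_abs[OF z])
  also have "\<dots> = ?v" by (rule sign_mats_mult_mult_vec[OF sign_mat_in v])
  finally have Sz: "?S *\<^sub>v z = ?v" .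
  have "(?S * A) *\<^sub>v ?v = ?S *\<^sub>v (A *\<^sub>v ?v)" using S A v by simp
  also have "\<dots> = (1 / s) \<cdot>\<^sub>v ?v" using S z by (simp add: Av mult_mat_vec Sz)
  finally show ?thesis .
qed

text \<open>The second claim says that the trio leads back to the given point, so every crossing at
  a positive time comes from a trio.\<close>

lemma crossing_abs_field_trio:
  assumes A: "A \<in> carrier_mat (Suc m) (Suc m)" and x: "x \<in> topspace (nsphere m)"
    and s: "0 < s" and cr: "crossing m (abs_field A) s x"
  defines "z \<equiv> Matrix.vec (Suc m) x"
  shows "eig_trio (Suc m) A (1 / s) (sign_mat (Suc m) z) (map_vec abs z)"
    and "vec_fun (sign_mat (Suc m) z *\<^sub>v map_vec abs z) = x"
proof -
  have z: "z \<in> carrier_vec (Suc m)" by (simp add: z_def)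
  have "z = s \<cdot>\<^sub>v (A *\<^sub>v map_vec abs z)"
  proof (rule eq_vecI)
    fix i assume i: "i < dim_vec (s \<cdot>\<^sub>v (A *\<^sub>v map_vec abs z))"
    then have "z $ i = s * abs_field A x i"
      using cr A by (simp add: crossing_def z_def)
    then show "z $ i = (s \<cdot>\<^sub>v (A *\<^sub>v map_vec abs z)) $ i"
      using i A by (simp add: abs_field_eq_mult_vec[OF A] z_def)
  qed (use A z in auto)
  from abs_fixed_eigenvector[OF A z s this]
  have ev: "(sign_mat (Suc m) z * A) *\<^sub>v map_vec abs z = (1 / s) \<cdot>\<^sub>v map_vec abs z" .
  have "map_vec abs z \<in> nonneg_unit_vecs (Suc m)"
    using x by (simp add: nonneg_unit_vecs_iff z_def topspace_nsphere lessThan_Suc_atMost)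
  with ev show "eig_trio (Suc m) A (1 / s) (sign_mat (Suc m) z) (map_vec abs z)"
    using s by (simp add: eig_trio_def sign_mat_in)
  show "vec_fun (sign_mat (Suc m) z *\<^sub>v map_vec abs z) = x"
    using x by (simp add: sign_mat_mult_abs[OF z]) (simp add: z_def vec_fun_vec)
qed

text \<open>Genericity speaks of \<open>S * A\<close>, the pencil in the orthant of \<open>S\<close>
  of \<open>A * S\<close>; the two are conjugate by \<open>S\<close>.\<close>

lemma char_poly_sign_commute:
  assumes A: "A \<in> carrier_mat n n" and S: "S \<in> sign_mats n"
  shows "char_poly (A * S) = char_poly (S * A)"
proof (rule char_poly_similar)
  have Sc: "S \<in> carrier_mat n n" using S by (simp add: sign_mats_def)
  have "S * (S * A) * S = (S * S) * A * S" using A Sc by simp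
  also have "\<dots> = A * S" using A by (simp add: sign_mats_square[OF S])
  finally show "similar_mat (A * S) (S * A)"
    using A Sc sign_mats_square[OF S] by (intro similar_matI[of _ _ S S n]) auto
qed

text \<open>The model is the linear field of \<open>A * S\<close>, which agrees with the field of
  absolute values on the orthant of \<open>S\<close>. The second claim makes the two-valued case
  distinction in the first equal to minus the sign of the derivative.\<close>

lemma odd_model_abs_field:
  assumes A: "A \<in> carrier_mat (Suc m) (Suc m)" and gen: "generic_mat (Suc m) A"
    and trio: "eig_trio (Suc m) A l S v" and l: "1 < l"
  shows "odd_model m (abs_field A) (vec_fun (S *\<^sub>v v)) (1 / l)
      (if poly (pderiv (char_poly (A * S))) l > 0 then - 1 else 1)"
    and "poly (pderiv (char_poly (A * S))) l \<noteq> 0"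
proof -
  let ?n = "Suc m" and ?T = "topspace (nsphere m)"
  define B where "B = A * S"
  define p where "p = char_poly B"
  define z where "z = vec_fun (S *\<^sub>v v)"
  have S: "S \<in> sign_mats ?n" and Sc: "S \<in> carrier_mat ?n ?n" and v: "v \<in> carrier_vec ?n"
    and vn: "(\<Sum>i<?n. (v $ i)\<^sup>2) = 1"
    using trio by (auto simp: eig_trio_def nonneg_unit_vecs_iff sign_mats_def)
  have vpos: "0 < v $ i" if "i < ?n" for i using generic_mat_trio(2)[OF gen trio] that by blast
  have B: "B \<in> carrier_mat ?n ?n" using A Sc by (simp add: B_def)
  have ps: "p = char_poly (S * A)" unfolding p_def B_def by (rule char_poly_sign_commute[OF A S])
  have "p \<noteq> 0" using degree_monic_char_poly[OF B] by (auto simp: p_def)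
  moreover have ord: "Polynomial.order l p = 1"
    using generic_mat_trio(1)[OF gen trio] by (simp add: ps simple_eigenvalue_def)
  ultimately have p': "poly (pderiv p) l \<noteq> 0"
    and "\<exists>d>0. \<forall>t. \<bar>t - l\<bar> \<le> d \<longrightarrow> sgn (poly p t) = sgn (t - l) * sgn (poly (pderiv p) l)"
    using simple_root_sgn by blast+
  then obtain d0 where d0: "0 < d0"
    "\<And>t. \<bar>t - l\<bar> \<le> d0 \<Longrightarrow> sgn (poly p t) = sgn (t - l) * sgn (poly (pderiv p) l)" by blast
  show "poly (pderiv (char_poly (A * S))) l \<noteq> 0" using p' by (simp add: p_def B_def)
  \<comment> \<open>The first bound keeps the sign description of \<open>p\<close> valid; the second
    keeps \<open>l - d\<close> above 1, so that the later end \<open>b\<close> of the time window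
    stays within the pencil.\<close>
  define d where "d = min d0 ((l - 1) / 2)"
  have d: "0 < d" "d \<le> d0" "1 < l - d" using d0(1) l by (auto simp: d_def min_def field_simps)
  define a where "a = 1 / (l + d)"
  define b where "b = 1 / (l - d)"
  have ab: "0 < a" "a < 1 / l" "1 / l < b" "b \<le> 1"
    using d l by (auto simp: a_def b_def field_simps)
  have zi: "z i = S $$ (i, i) * v $ i" if "i < ?n" for i
    using that Sc sign_mats_mult_vec_index[OF S v] by (simp add: z_def vec_fun_def del: index_mult_mat_vec)
  have Sii: "S $$ (i, i) = 1 \<or> S $$ (i, i) = - 1" if "i < ?n" for i
    using S that by (auto simp: sign_mats_def)
  have zz: "(z i)\<^sup>2 = (v $ i)\<^sup>2" if "i < ?n" for i
    using Sii[OF that] by (auto simp: zi[OF that] power_mult_distrib)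
  \<comment> \<open>The coordinates of \<open>z\<close> have absolute values \<open>v $ i\<close>;
    at squared distance below the smallest square no coordinate can change its sign.\<close>
  define r where "r = Min ((\<lambda>i. (v $ i)\<^sup>2) ` {..<?n})"
  have "r \<in> (\<lambda>i. (v $ i)\<^sup>2) ` {..<?n}" unfolding r_def by (rule Min_in) auto
  then have r0: "0 < r" using vpos by fastforce
  have rle: "r \<le> (v $ i)\<^sup>2" if "i < ?n" for i unfolding r_def using that by (intro Min_le) auto
  have near: "abs_field A x i = mat_field B x i" if x: "sqdist m x z < r" and i: "i \<le> m" for x i
  proof -
    have "mat_field S x j = \<bar>x j\<bar>" if j: "j < ?n" for j
    proof -
      have "(x j - z j)\<^sup>2 \<le> sqdist m x z" unfolding sqdist_def using j by (intro member_le_sum) auto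
      then have sq: "(x j - z j)\<^sup>2 < (v $ j)\<^sup>2" using x rle[OF j] by simp
      have *: "\<bar>x j - z j\<bar> < v $ j"
        by (rule power2_less_imp_less) (use sq vpos[OF j] in \<open>simp_all add: less_imp_le\<close>)
      have "mat_field S x j = S $$ (j, j) * x j"
        using sign_mats_mult_vec_index[OF S _ j, of "Matrix.vec ?n x"] j by (simp add: mat_field_eq_mult_vec[OF Sc j])
      then show ?thesis using Sii[OF j] * zi[OF j] by (elim disjE) simp_all
    qed
    then have "mat_field A (mat_field S x) i = mat_field A (\<lambda>j. \<bar>x j\<bar>) i"
      using A unfolding mat_field_def[of A] by (intro sum.cong) auto
    then show ?thesis using mat_field_mult[OF A Sc, of i x] i by (simp add: abs_field_def B_def)
  qed
  have only: "s = 1 / l \<and> (x = z \<or> x = (\<lambda>i. - z i))"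
    if s: "a \<le> s" "s \<le> b" and x: "x \<in> ?T" and cr: "crossing m (mat_field B) s x" for s x
  proof -
    let ?x = "Matrix.vec ?n x"
    have s0: "0 < s" using s ab by simp
    have fx: "?x = s \<cdot>\<^sub>v (B *\<^sub>v ?x)" using cr crossing_mat_field_iff[OF B] by blast
    have "(1 / s) \<cdot>\<^sub>v ?x = (1 / s) \<cdot>\<^sub>v (s \<cdot>\<^sub>v (B *\<^sub>v ?x))"
      by (rule arg_cong[OF fx])
    then have Bx: "B *\<^sub>v ?x = (1 / s) \<cdot>\<^sub>v ?x" using s0 by (simp add: smult_smult_assoc)
    have xn: "(\<Sum>i<?n. (x i)\<^sup>2) = 1" using x by (simp add: topspace_nsphere lessThan_Suc_atMost)
    have "?x \<noteq> 0\<^sub>v ?n"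
    proof
      assume 0: "?x = 0\<^sub>v ?n"
      have "x i = 0" if "i < ?n" for i using arg_cong[OF 0, of "\<lambda>w. w $ i"] that by simp
      then show False using xn by simp
    qed
    then have "eigenvector B ?x (1 / s)" using B Bx by (simp add: eigenvector_def)
    then have "poly p (1 / s) = 0"
      using eigenvalue_root_char_poly[OF B] unfolding p_def eigenvalue_def by blast
    moreover have "l - d \<le> 1 / s" "1 / s \<le> l + d"
      using s s0 d l by (auto simp: a_def b_def field_simps)
    then have "\<bar>1 / s - l\<bar> \<le> d0" using d(2) by linarith
    ultimately have "sgn (1 / s - l) = 0" using d0(2)[of "1 / s"] p' by (simp add: sgn_zero_iff)
    then have sl: "1 / s = l" by (simp add: sgn_zero_iff)
    have s1: "s = 1 / l" unfolding sl[symmetric] by simp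
    \<comment> \<open>\<open>S\<close> carries the eigenspace of \<open>A * S\<close> to that of
      \<open>S * A\<close>, which genericity makes a line; hence \<open>x\<close> is a multiple of
      \<open>z\<close>, and both are unit vectors.\<close>
    have "(S * A) *\<^sub>v (S *\<^sub>v ?x) = S *\<^sub>v (B *\<^sub>v ?x)"
      using A Sc by (simp add: B_def)
    also have "\<dots> = l \<cdot>\<^sub>v (S *\<^sub>v ?x)"
      using Sc by (simp add: Bx sl mult_mat_vec)
    finally have "(S * A) *\<^sub>v (S *\<^sub>v ?x) = l \<cdot>\<^sub>v (S *\<^sub>v ?x)" .
    from generic_mat_eigenspace[OF A gen trio zero_less_Suc mult_mat_vec_carrier[OF Sc vec_carrier] this]
    obtain c where c: "S *\<^sub>v ?x = c \<cdot>\<^sub>v v" by blast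
    have "?x = S *\<^sub>v (S *\<^sub>v ?x)" by (rule sign_mats_mult_mult_vec[OF S, symmetric]) simp
    also have "\<dots> = c \<cdot>\<^sub>v (S *\<^sub>v v)" using Sc v by (simp add: c mult_mat_vec)
    finally have xc: "?x = c \<cdot>\<^sub>v (S *\<^sub>v v)" .
    have xi: "x i = c * z i" if "i < ?n" for i
      using arg_cong[OF xc, of "\<lambda>w. w $ i"] that Sc sign_mats_mult_vec_index[OF S v]
      by (simp add: zi del: index_mult_mat_vec)
    have "(\<Sum>i<?n. (x i)\<^sup>2) = (\<Sum>i<?n. c\<^sup>2 * (v $ i)\<^sup>2)"
      by (intro sum.cong) (auto simp: xi zz power_mult_distrib)
    also have "\<dots> = c\<^sup>2" using vn by (simp flip: sum_distrib_left)
    finally have "c\<^sup>2 = 1" using xn by simp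
    then have "c = 1 \<or> c = - 1" by (simp add: power2_eq_1_iff)
    moreover have "x i = c * z i" for i
    proof (cases "i < ?n")
      case False
      then show ?thesis using x Sc by (simp add: topspace_nsphere z_def vec_fun_def)
    qed (rule xi)
    ultimately have "x = z \<or> x = (\<lambda>i. - z i)" by (auto simp: fun_eq_iff)
    then show ?thesis using s1 by blast
  qed
  \<comment> \<open>The earlier time \<open>a\<close> belongs to the larger value
    \<open>l + d\<close>: going from \<open>a\<close> to \<open>b\<close> traverses the root
    backwards, which is the origin of the minus sign.\<close>
  have pa: "sgn (poly p (1 / a)) = sgn (poly (pderiv p) l)"
    and pb: "sgn (poly p (1 / b)) = - sgn (poly (pderiv p) l)"
    using d0(2)[of "l + d"] d0(2)[of "l - d"] d by (auto simp: a_def b_def)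
  have nz: "poly p (1 / a) \<noteq> 0" "poly p (1 / b) \<noteq> 0"
    using pa pb p' by (metis neg_equal_0_iff_equal sgn_zero_iff)+
  let ?\<kappa> = "if poly (pderiv p) l > 0 then - 1 else 1 :: int"
  have "real_of_int (field_degree m (pencil_field (mat_field B) (\<lambda>x. b))
      - field_degree m (pencil_field (mat_field B) (\<lambda>x. a))) = - 2 * sgn (poly (pderiv p) l)"
    using ab nz pa pb by (simp add: field_degree_pencil_mat_const[OF B, folded p_def])
  also have "\<dots> = real_of_int (2 * ?\<kappa>)" using p' by (simp add: sgn_if)
  finally have jump: "2 * ?\<kappa> = field_degree m (pencil_field (mat_field B) (\<lambda>x. b))
      - field_degree m (pencil_field (mat_field B) (\<lambda>x. a))"
    by (simp only: of_int_eq_iff)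
  have odd: "mat_field B (\<lambda>j. - x j) i = - mat_field B x i" for x i
    by (simp add: mat_field_def sum_negf)
  have "odd_model m (abs_field A) z (1 / l) ?\<kappa>"
    unfolding odd_model_def
  proof (rule exI[of _ "mat_field B"], rule exI[of _ a], rule exI[of _ b], rule exI[of _ r], intro conjI)
    show "\<forall>i\<le>m. continuous_map (nsphere m) euclideanreal (\<lambda>x. mat_field B x i)"
      by (simp add: continuous_map_mat_field)
    show "\<forall>x i. mat_field B (\<lambda>j. - x j) i = - mat_field B x i" by (simp add: odd)
    show "\<forall>x\<in>?T. sqdist m x z < r \<longrightarrow> (\<forall>i\<le>m. abs_field A x i = mat_field B x i)"
      by (simp add: near)
    show "\<forall>s x. a \<le> s \<and> s \<le> b \<and> x \<in> ?T \<and> crossing m (mat_field B) s x \<longrightarrow>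
        s = 1 / l \<and> (x = z \<or> x = (\<lambda>i. - z i))"
      by (intro allI impI, elim conjE, rule only)
  qed (fact r0 less_imp_le[OF ab(1)] ab jump)+
  then show "odd_model m (abs_field A) (vec_fun (S *\<^sub>v v)) (1 / l)
      (if poly (pderiv (char_poly (A * S))) l > 0 then - 1 else 1)"
    by (simp only: z_def p_def B_def)
qed

lemma the_mat_inverse:
  assumes P: "P \<in> carrier_mat n n" and inv: "invertible_mat (P :: real mat)"
  shows "the (mat_inverse P) \<in> carrier_mat n n" "P * the (mat_inverse P) = 1\<^sub>m n"
    "the (mat_inverse P) * P = 1\<^sub>m n"
proof -
  obtain Q where Q: "inverts_mat P Q" "inverts_mat Q P"
    using inv by (auto simp: invertible_mat_def)
  have PQ: "P * Q = 1\<^sub>m n" using Q(1) P by (simp add: inverts_mat_def)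
  have QP: "Q * P = 1\<^sub>m (dim_row Q)" using Q(2) by (simp add: inverts_mat_def)
  \<comment> \<open>\<open>invertible_mat\<close> leaves the dimensions of the witness open; they
    are read off from the two products.\<close>
  have "dim_col Q = n" using arg_cong[OF PQ, of dim_col] by simp
  moreover have "dim_row Q = n" using arg_cong[OF QP, of dim_col] P by simp
  ultimately have Qc: "Q \<in> carrier_mat n n" by auto
  have "P \<in> Units (ring_mat TYPE(real) n ())"
    using P Qc PQ QP by (auto simp: Units_def ring_mat_def)
  then obtain R where "mat_inverse P = Some R"
    using mat_inverse(1)[OF P, where b = "()"] by (cases "mat_inverse P") auto
  then show "the (mat_inverse P) \<in> carrier_mat n n" "P * the (mat_inverse P) = 1\<^sub>m n"
    "the (mat_inverse P) * P = 1\<^sub>m n"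
    using mat_inverse(2)[OF P] by auto
qed

text \<open>The eigenspace is a line, and a line contains at most one positive unit vector.\<close>

lemma eig_trio_unique_vec:
  assumes A: "A \<in> carrier_mat n n" and gen: "generic_mat n A" and n: "0 < n"
    and t: "eig_trio n A l S v" "eig_trio n A l S w"
  shows "v = w"
proof -
  have v: "v \<in> carrier_vec n" "(\<Sum>i<n. (v $ i)\<^sup>2) = 1" and w: "w \<in> carrier_vec n" "(\<Sum>i<n. (w $ i)\<^sup>2) = 1"
    and ew: "(S * A) *\<^sub>v w = l \<cdot>\<^sub>v w"
    using t by (auto simp: eig_trio_def nonneg_unit_vecs_iff)
  obtain c where c: "w = c \<cdot>\<^sub>v v"
    using generic_mat_eigenspace[OF A gen t(1) n w(1) ew] by blast
  have pos: "0 < v $ 0" "0 < w $ 0"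
    using generic_mat_trio(2)[OF gen t(1)] generic_mat_trio(2)[OF gen t(2)] n by blast+
  have "w $ 0 = c * v $ 0" using c v n by simp
  then have "0 < c" using pos by (simp add: zero_less_mult_iff)
  have "(\<Sum>i<n. (w $ i)\<^sup>2) = (\<Sum>i<n. c\<^sup>2 * (v $ i)\<^sup>2)"
    using c v by (intro sum.cong) (auto simp: power_mult_distrib)
  also have "\<dots> = c\<^sup>2" using v by (simp flip: sum_distrib_left)
  finally have "c = 1" using w \<open>0 < c\<close> by (simp add: power2_eq_1_iff)
  then show ?thesis using c v by simp
qed

text \<open>By uniqueness a trio is determined by \<open>S\<close> and \<open>l\<close>; there are
  finitely many sign matrices, and for each of them \<open>l\<close> is a root of a nonzero
  polynomial.\<close>

lemma finite_eig_trios: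
  assumes A: "A \<in> carrier_mat n n" and gen: "generic_mat n A" and n: "0 < n"
  shows "finite {(l, S, v). eig_trio n A l S v}"
proof -
  let ?T = "{(l, S, v). eig_trio n A l S v}" and ?f = "\<lambda>(l, S, v :: real vec). (S, l)"
  have "inj_on ?f ?T"
    using eig_trio_unique_vec[OF A gen n] by (auto simp: inj_on_def)
  moreover have "?f ` ?T \<subseteq> (SIGMA S:sign_mats n. {l. poly (char_poly (S * A)) l = 0})"
  proof (rule image_subsetI)
    fix x assume "x \<in> ?T"
    then obtain l S v where x: "x = (l, S, v)" and t: "eig_trio n A l S v" by auto
    then have S: "S \<in> sign_mats n" by (simp add: eig_trio_def)
    then have "S * A \<in> carrier_mat n n" using A by (auto simp: sign_mats_def)
    then have "poly (char_poly (S * A)) l = 0"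
      using generic_mat_trio(1)[OF gen t] eigenvalue_root_char_poly by (auto simp: simple_eigenvalue_def)
    then show "?f x \<in> (SIGMA S:sign_mats n. {l. poly (char_poly (S * A)) l = 0})"
      using S x by simp
  qed
  moreover have "finite (SIGMA S:sign_mats n. {l. poly (char_poly (S * A)) l = 0})"
  proof (intro finite_SigmaI finite_sign_mats poly_roots_finite)
    fix S assume "S \<in> sign_mats n"
    then have "S * A \<in> carrier_mat n n" using A by (auto simp: sign_mats_def)
    then show "char_poly (S * A) \<noteq> 0" using degree_monic_char_poly[of "S * A" n] by auto
  qed
  ultimately show ?thesis using finite_subset inj_on_finite by metis
qed

text \<open>Strict positivity makes \<open>S\<close> recoverable from the point: absolute values
  give the vector and signs give \<open>S\<close>, none being hidden by a zero coordinate. The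
  eigenvalue then follows.\<close>

lemma eig_trio_point_inj:
  assumes A: "A \<in> carrier_mat n n" and gen: "generic_mat n A" and n: "0 < n"
    and t: "eig_trio n A l S v" "eig_trio n A k T w"
    and eq: "vec_fun (S *\<^sub>v v) = vec_fun (T *\<^sub>v w)"
  shows "l = k \<and> S = T \<and> v = w"
proof -
  have S: "S \<in> sign_mats n" "S \<in> carrier_mat n n" and T: "T \<in> sign_mats n" "T \<in> carrier_mat n n"
    and v: "v \<in> carrier_vec n" and w: "w \<in> carrier_vec n"
    and ev: "(S * A) *\<^sub>v v = l \<cdot>\<^sub>v v" and ew: "(T * A) *\<^sub>v w = k \<cdot>\<^sub>v w"
    using t by (auto simp: eig_trio_def nonneg_unit_vecs_iff sign_mats_def)
  have vpos: "0 < v $ i" "0 < w $ i" if "i < n" for i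
    using generic_mat_trio(2)[OF gen t(1)] generic_mat_trio(2)[OF gen t(2)] that by blast+
  have e: "S $$ (i, i) * v $ i = T $$ (i, i) * w $ i" if "i < n" for i
    using fun_cong[OF eq, of i] that S(2) T(2) sign_mats_mult_vec_index[OF S(1) v that]
      sign_mats_mult_vec_index[OF T(1) w that]
    by (simp add: vec_fun_def del: index_mult_mat_vec)
  have vw: "v $ i = w $ i" if "i < n" for i
  proof -
    have "\<bar>S $$ (i, i) * v $ i\<bar> = \<bar>T $$ (i, i) * w $ i\<bar>" by (simp add: e[OF that])
    then show ?thesis
      using vpos[OF that] that by (simp add: abs_mult sign_mats_abs_diag[OF S(1)] sign_mats_abs_diag[OF T(1)])
  qed
  then have "v = w" using v w by (intro eq_vecI) auto
  moreover have "S = T"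
  proof (rule eq_matI)
    fix i j assume "i < dim_row T" "j < dim_col T"
    then have ij: "i < n" "j < n" using T(2) by auto
    show "S $$ (i, j) = T $$ (i, j)"
    proof (cases "i = j")
      case True
      then show ?thesis using e[OF ij(1)] vw[OF ij(1)] vpos(1)[OF ij(1)] by simp
    next
      case False
      then show ?thesis using ij S T by (simp add: sign_mats_def diagonal_mat_def)
    qed
  qed (use S T in auto)
  moreover have "l = k"
  proof -
    have "l \<cdot>\<^sub>v v = k \<cdot>\<^sub>v v" using ev ew \<open>v = w\<close> \<open>S = T\<close> by simp
    from arg_cong[OF this, of "\<lambda>u :: real vec. u $ 0"] show ?thesis using v n vpos(1)[OF n] by simp
  qed
  ultimately show ?thesis by blast
qed

lemma field_degree_abs_field:
  assumes A: "A \<in> carrier_mat (Suc m) (Suc m)" and gen: "generic_mat (Suc m) A"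
    and one: "\<nexists>S v. eig_trio (Suc m) A 1 S v"
  shows "field_on_sphere m (pencil_field (abs_field A) (\<lambda>x. 1))"
    and "real_of_int (field_degree m (pencil_field (abs_field A) (\<lambda>x. 1))) =
      1 - (\<Sum>(l, S, v) \<in> {(l, S, v). eig_trio (Suc m) A l S v \<and> l > 1}.
             sgn (poly (pderiv (char_poly (A * S))) l))"
proof -
  let ?n = "Suc m" and ?C = "abs_field A"
  define I where "I = {(l, S, v). eig_trio ?n A l S v \<and> l > 1}"
  define zp where "zp = (\<lambda>(l :: real, S, v). vec_fun (S *\<^sub>v v))"
  define sv where "sv = (\<lambda>(l, S :: real mat, v :: real vec). 1 / l :: real)"
  define \<kappa> where "\<kappa> = (\<lambda>(l, S, v :: real vec). if poly (pderiv (char_poly (A * S))) l > 0 then - 1 else 1 :: int)"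
  have "\<not> crossing m ?C 1 x" if "x \<in> topspace (nsphere m)" for x
    using crossing_abs_field_trio(1)[OF A that, of 1] one by auto
  then show "field_on_sphere m (pencil_field ?C (\<lambda>x. 1))"
    by (intro field_on_sphere_pencil continuous_map_abs_field) auto
  have "field_degree m (pencil_field ?C (\<lambda>x. 1)) = 1 + (\<Sum>i\<in>I. \<kappa> i)"
  proof (rule field_degree_pencil_sum)
    show "finite I"
      by (rule finite_subset[OF _ finite_eig_trios[OF A gen]]) (auto simp: I_def)
    show "inj_on zp I"
      unfolding inj_on_def I_def zp_def using eig_trio_point_inj[OF A gen zero_less_Suc]
      by clarsimp
    show "zp i \<in> topspace (nsphere m)" if "i \<in> I" for i
    proof -
      obtain l S v where i: "i = (l, S, v)" "eig_trio ?n A l S v" using \<open>i \<in> I\<close> by (auto simp: I_def)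
      then have S: "S \<in> sign_mats ?n" "S \<in> carrier_mat ?n ?n" and v: "v \<in> carrier_vec ?n" "(\<Sum>j<?n. (v $ j)\<^sup>2) = 1"
        by (auto simp: eig_trio_def nonneg_unit_vecs_iff sign_mats_def)
      have "(\<Sum>j<?n. ((S *\<^sub>v v) $ j)\<^sup>2) = (\<Sum>j<?n. (v $ j)\<^sup>2)"
      proof (rule sum.cong)
        fix j assume "j \<in> {..<?n}"
        then have j: "j < ?n" by simp
        then have "(S $$ (j, j))\<^sup>2 = 1" using S by (auto simp: sign_mats_def)
        then show "((S *\<^sub>v v) $ j)\<^sup>2 = (v $ j)\<^sup>2"
          by (simp add: sign_mats_mult_vec_index[OF S(1) v(1) j] power_mult_distrib del: index_mult_mat_vec)
      qed simp
      then show ?thesis using i v(2) vec_fun_in_nsphere[OF mult_mat_vec_carrier[OF S(2) v(1)]]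
        by (simp add: zp_def)
    qed
    show "0 < sv i \<and> sv i < 1" if "i \<in> I" for i using that by (auto simp: I_def sv_def)
    show "\<exists>i\<in>I. x = zp i \<and> s = sv i"
      if s: "0 \<le> s" "s \<le> 1" and x: "x \<in> topspace (nsphere m)" and cr: "crossing m ?C s x" for s x
    proof -
      have "s \<noteq> 0"
      proof
        assume "s = 0"
        then have "x i = 0" if "i \<le> m" for i using cr that by (simp add: crossing_def)
        then show False using x by (simp add: topspace_nsphere)
      qed
      then have s0: "0 < s" using s by simp
      note t = crossing_abs_field_trio[OF A x s0 cr]
      \<comment> \<open>A crossing at the end of the pencil would be a trio with value 1; all others
        have a value above 1.\<close>
      have "s \<noteq> 1" using t(1) one by auto
      then have "1 / s > 1" using s s0 by simp
      then show ?thesis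
        using t by (intro bexI[of _ "(1 / s, sign_mat ?n (Matrix.vec ?n x), map_vec abs (Matrix.vec ?n x))"])
          (simp_all add: zp_def sv_def I_def)
    qed
    show "odd_model m ?C (zp i) (sv i) (\<kappa> i)" if "i \<in> I" for i
      using that odd_model_abs_field(1)[OF A gen] by (auto simp: I_def zp_def sv_def \<kappa>_def simp del: if_cancel)
  qed (rule continuous_map_abs_field)
  then have "real_of_int (field_degree m (pencil_field ?C (\<lambda>x. 1))) = 1 + (\<Sum>i\<in>I. real_of_int (\<kappa> i))"
    by simp
  \<comment> \<open>At a vanishing derivative \<open>\<kappa>\<close> would be 1 while the sign is
    0; simplicity of the root rules this out.\<close>
  also have "(\<Sum>i\<in>I. real_of_int (\<kappa> i)) = (\<Sum>(l, S, v)\<in>I. - sgn (poly (pderiv (char_poly (A * S))) l))"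
    by (intro sum.cong refl) (use odd_model_abs_field(2)[OF A gen] in \<open>auto simp: I_def \<kappa>_def sgn_if\<close>)
  finally show "real_of_int (field_degree m (pencil_field ?C (\<lambda>x. 1))) =
      1 - (\<Sum>(l, S, v) \<in> {(l, S, v). eig_trio ?n A l S v \<and> l > 1}.
             sgn (poly (pderiv (char_poly (A * S))) l))"
    by (simp add: I_def case_prod_unfold sum_negf)
qed

section \<open>Translation between the complementarity map and the pencil\<close>

text \<open>Factoring \<open>P\<close> out of the pencil on the left lets each summand absorb the
  sign of \<open>det P\<close>, the degree of the linear factor of the map.\<close>

lemma gen_char_poly_factor:
  fixes P :: "real mat"
  assumes P: "P \<in> carrier_mat n n" and B: "B \<in> carrier_mat n n"
  shows "gen_char_poly P (P * B) = Polynomial.smult (Determinant.det P) (char_poly B)"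
proof (rule poly_ext)
  fix t
  have "t \<cdot>\<^sub>m P - P * B = P * (- char_matrix B t)"
  proof -
    have "P * (- char_matrix B t) = P * (t \<cdot>\<^sub>m 1\<^sub>m n - B)"
      using B by (intro arg_cong[where f = "\<lambda>X. P * X"] eq_matI) (auto simp: char_matrix_def)
    also have "\<dots> = t \<cdot>\<^sub>m P - P * B"
      using mult_minus_distrib_mat[OF P, of "t \<cdot>\<^sub>m 1\<^sub>m n" n B] mult_smult_distrib[OF P, of "1\<^sub>m n" n t] P B
      by simp
    finally show ?thesis by simp
  qed
  then have "Determinant.det (t \<cdot>\<^sub>m P - P * B) = Determinant.det (P * (- char_matrix B t))"
    by (rule arg_cong)
  also have "\<dots> = Determinant.det P * Determinant.det (- char_matrix B t)"
    using B by (intro det_mult[OF P]) (simp add: char_matrix_def)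
  finally show "poly (gen_char_poly P (P * B)) t = poly (Polynomial.smult (Determinant.det P) (char_poly B)) t"
    using P B by (simp add: poly_gen_char_poly[of _ n] char_poly_matrix[OF B])
qed

text \<open>Multiplication by \<open>R\<close> and then by \<open>S\<close> passes from left to
  right and is reversible, \<open>S\<close> being its own inverse.\<close>

lemma aligned_iff_eig_trio:
  assumes P: "P \<in> carrier_mat n n" and R: "R \<in> carrier_mat n n" "R * P = 1\<^sub>m n" "P * R = 1\<^sub>m n"
    and N: "N \<in> carrier_mat n n" and S: "S \<in> sign_mats n" and v: "v \<in> carrier_vec n"
  shows "N *\<^sub>v v = l \<cdot>\<^sub>v (P *\<^sub>v (S *\<^sub>v v)) \<longleftrightarrow> (S * (R * N)) *\<^sub>v v = l \<cdot>\<^sub>v v"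
proof -
  have Sc: "S \<in> carrier_mat n n" using S by (simp add: sign_mats_def)
  have PR: "P *\<^sub>v (R *\<^sub>v u) = u" "R *\<^sub>v (P *\<^sub>v u) = u" if "u \<in> carrier_vec n" for u
    using that P R by (metis assoc_mult_mat_vec one_mult_mat_vec)+
  have SS: "S *\<^sub>v (S *\<^sub>v u) = u" if "u \<in> carrier_vec n" for u
    by (rule sign_mats_mult_mult_vec[OF S that])
  have e: "(S * (R * N)) *\<^sub>v v = S *\<^sub>v (R *\<^sub>v (N *\<^sub>v v))"
    using assoc_mult_mat_vec[OF Sc mult_carrier_mat[OF R(1) N] v] assoc_mult_mat_vec[OF R(1) N v] by simp
  show ?thesis
  proof
    assume "N *\<^sub>v v = l \<cdot>\<^sub>v (P *\<^sub>v (S *\<^sub>v v))"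
    then show "(S * (R * N)) *\<^sub>v v = l \<cdot>\<^sub>v v"
      using Sc R P v by (simp add: e mult_mat_vec PR SS)
  next
    assume a: "(S * (R * N)) *\<^sub>v v = l \<cdot>\<^sub>v v"
    have "N *\<^sub>v v = P *\<^sub>v (S *\<^sub>v (S *\<^sub>v (R *\<^sub>v (N *\<^sub>v v))))"
      using Sc R P N v by (simp add: PR SS)
    also have "\<dots> = l \<cdot>\<^sub>v (P *\<^sub>v (S *\<^sub>v v))"
      using Sc P v by (simp add: a[unfolded e] mult_mat_vec)
    finally show "N *\<^sub>v v = l \<cdot>\<^sub>v (P *\<^sub>v (S *\<^sub>v v))" .
  qed
qed

lemma lcp_map_eq:
  assumes M: "M \<in> carrier_mat n n" and R: "R \<in> carrier_mat n n" "(M + 1\<^sub>m n) * R = 1\<^sub>m n"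
    and z: "z \<in> carrier_vec n"
  shows "lcp_map n M z = ((1/2) \<cdot>\<^sub>m (M + 1\<^sub>m n)) *\<^sub>v (z - (R * (M - 1\<^sub>m n)) *\<^sub>v map_vec abs z)"
proof -
  let ?P = "M + 1\<^sub>m n" and ?N = "M - 1\<^sub>m n" and ?v = "map_vec abs z"
  have P: "?P \<in> carrier_mat n n" and N: "?N \<in> carrier_mat n n" and v: "?v \<in> carrier_vec n" using M z by auto
  have "?P *\<^sub>v ((R * ?N) *\<^sub>v ?v) = (?P * R) *\<^sub>v (?N *\<^sub>v ?v)"
    using assoc_mult_mat_vec[OF P R(1) mult_mat_vec_carrier[OF N v]] assoc_mult_mat_vec[OF R(1) N v] by simp
  also have "\<dots> = ?N *\<^sub>v ?v" using R(2) N v by simp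
  finally have *: "?P *\<^sub>v ((R * ?N) *\<^sub>v ?v) = ?N *\<^sub>v ?v" .
  have "((1/2) \<cdot>\<^sub>m ?P) *\<^sub>v (z - (R * ?N) *\<^sub>v ?v) = (1/2) \<cdot>\<^sub>v (?P *\<^sub>v (z - (R * ?N) *\<^sub>v ?v))"
    using P R N v z by (intro eq_vecI) auto
  also have "?P *\<^sub>v (z - (R * ?N) *\<^sub>v ?v) = ?P *\<^sub>v z - ?N *\<^sub>v ?v"
    unfolding *[symmetric]
    by (rule mult_minus_distrib_mat_vec[OF P z mult_mat_vec_carrier[OF mult_carrier_mat[OF R(1) N] v]])
  also have "(1/2) \<cdot>\<^sub>v (?P *\<^sub>v z - ?N *\<^sub>v ?v) = lcp_map n M z"
    unfolding lcp_map_def using P N v z by (intro eq_vecI) (auto simp: algebra_simps)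
  finally show ?thesis by simp
qed

theorem theorem5p6:
  fixes n :: nat and M :: "real mat"
  assumes "n \<ge> 1"
    and "M \<in> carrier_mat n n"
    and "lcp_generic n M"
    and "1 \<notin> lcp_aligned_spec n M"
  shows "nondegenerate_map n (lcp_map n M) \<and>
    finite {(l, S, v). (l, S, v) \<in> lcp_aligned_trios n M \<and> l > 1} \<and>
    real_of_int (map_degree n (lcp_map n M)) =
      sgn (Determinant.det (M + 1\<^sub>m n)) -
      (\<Sum>(l, S, v) \<in> {(l, S, v). (l, S, v) \<in> lcp_aligned_trios n M \<and> l > 1}.
         sgn (poly (pderiv (gen_char_poly (M + 1\<^sub>m n) ((M - 1\<^sub>m n) * S))) l))"
proof -
  obtain m where n: "n = Suc m" using assms(1) by (cases n) auto
  then have n0: "0 < n" by simp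
  define P where "P = M + 1\<^sub>m n"
  define N where "N = M - 1\<^sub>m n"
  define R where "R = the (mat_inverse P)"
  define A where "A = R * N"
  have P: "P \<in> carrier_mat n n" and N: "N \<in> carrier_mat n n" using assms(2) by (auto simp: P_def N_def)
  have R: "R \<in> carrier_mat n n" "P * R = 1\<^sub>m n" "R * P = 1\<^sub>m n"
    using the_mat_inverse[OF P] assms(3) by (auto simp: lcp_generic_def P_def R_def)
  have A: "A \<in> carrier_mat n n" using R N by (simp add: A_def)
  have gen: "generic_mat n A"
    using assms(3) by (simp add: lcp_generic_def A_def R_def N_def P_def)
  have PA: "P * A = N" using P R N by (simp add: A_def flip: assoc_mult_mat[of P n n R n N n])
  have detP: "Determinant.det P \<noteq> 0"
  proof
    assume "Determinant.det P = 0"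
    moreover have "Determinant.det P * Determinant.det R = 1"
      using det_mult[OF P R(1)] R(2) by simp
    ultimately show False by simp
  qed
  have trio: "(l, S, v) \<in> lcp_aligned_trios n M \<longleftrightarrow> eig_trio n A l S v" for l S v
    using aligned_iff_eig_trio[OF P R(1,3,2) N, of S v l]
    by (auto simp: lcp_aligned_trios_def eig_trio_def P_def[symmetric] N_def[symmetric] A_def nonneg_unit_vecs_def)
  have one: "\<nexists>S v. eig_trio n A 1 S v"
    using assms(4) trio by (auto simp: lcp_aligned_spec_def)
  have lcp: "lcp_map n M z = ((1/2) \<cdot>\<^sub>m P) *\<^sub>v (z - A *\<^sub>v map_vec abs z)" if "z \<in> carrier_vec n" for z
    using lcp_map_eq[OF assms(2) R(1) _ that] R(2) by (simp add: P_def N_def A_def)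
  have "Determinant.det ((1/2) \<cdot>\<^sub>m P) = (1/2) ^ n * Determinant.det P"
    using P by simp
  then have hP: "(1/2) \<cdot>\<^sub>m P \<in> carrier_mat n n" "Determinant.det ((1/2) \<cdot>\<^sub>m P) \<noteq> 0"
    "sgn (Determinant.det ((1/2) \<cdot>\<^sub>m P)) = sgn (Determinant.det P)"
    using P detP by (auto simp: sgn_mult)
  \<comment> \<open>A nonzero zero is a fixed point at time 1; its absolute value, scaled to unit
    length, would give a trio with value 1.\<close>
  have "nondegenerate_map n (lcp_map n M)"
    unfolding nondegenerate_map_def
  proof (intro ballI impI, rule ccontr)
    fix z assume z: "z \<in> carrier_vec n" "lcp_map n M z = 0\<^sub>v n" "z \<noteq> 0\<^sub>v n"
    let ?y = "z - A *\<^sub>v map_vec abs z" and ?v = "map_vec abs z" and ?S = "sign_mat n z"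
    have y: "?y \<in> carrier_vec n" using z A by simp
    have "?y = 0\<^sub>v n"
      using det_0_iff_vec_prod_zero[OF hP(1)] hP(2) y lcp[OF z(1)] z(2) by metis
    then have "z = 1 \<cdot>\<^sub>v (A *\<^sub>v ?v)"
    proof -
      have "z $ i = (A *\<^sub>v ?v) $ i" if "i < n" for i
        using arg_cong[OF \<open>?y = 0\<^sub>v n\<close>, of "\<lambda>w. w $ i"] that z(1) A by simp
      then show ?thesis using z(1) A by (intro eq_vecI) auto
    qed
    from abs_fixed_eigenvector[OF A z(1) _ this]
    have ev: "(?S * A) *\<^sub>v ?v = 1 \<cdot>\<^sub>v ?v" by simp
    have v: "?v \<in> carrier_vec n" using z by simp
    have "?v \<noteq> 0\<^sub>v n"
    proof
      assume 0: "?v = 0\<^sub>v n"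
      have "z $ i = 0" if "i < n" for i
        using arg_cong[OF 0, of "\<lambda>w. w $ i"] that z(1) by simp
      then have "z = 0\<^sub>v n" using z(1) by (intro eq_vecI) auto
      then show False using z(3) by simp
    qed
    then obtain c where c: "0 < c" "c \<cdot>\<^sub>v ?v \<in> nonneg_unit_vecs n"
      using scale_in_nonneg_unit_vecs[OF v] z(1) by auto
    have "?S * A \<in> carrier_mat n n"
      by (rule mult_carrier_mat[OF _ A]) (simp add: sign_mat_def)
    then have "(?S * A) *\<^sub>v (c \<cdot>\<^sub>v ?v) = 1 \<cdot>\<^sub>v (c \<cdot>\<^sub>v ?v)"
      using v by (simp add: mult_mat_vec ev)
    then have "eig_trio n A 1 ?S (c \<cdot>\<^sub>v ?v)"
      using c by (simp add: eig_trio_def sign_mat_in)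
    then show False using one by blast
  qed
  \<comment> \<open>A sum over an infinite set is 0 by convention, so finiteness is what gives the
    formula its meaning.\<close>
  moreover have "finite {(l, S, v). (l, S, v) \<in> lcp_aligned_trios n M \<and> l > 1}"
    by (rule finite_subset[OF _ finite_eig_trios[OF A gen n0]]) (auto simp: trio)
  moreover have "real_of_int (map_degree n (lcp_map n M)) =
      sgn (Determinant.det P) -
      (\<Sum>(l, S, v) \<in> {(l, S, v). (l, S, v) \<in> lcp_aligned_trios n M \<and> l > 1}.
         sgn (poly (pderiv (gen_char_poly P (N * S))) l))"
  proof -
    let ?F = "pencil_field (abs_field A) (\<lambda>x. 1)"
    note F = field_degree_abs_field[OF A[unfolded n] gen[unfolded n] one[unfolded n]]
    \<comment> \<open>The linear factor is kept outermost, being homogeneous as multiplicativity of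
      the degree requires.\<close>
    have "map_degree n (lcp_map n M) = field_degree m (\<lambda>x. mat_field ((1/2) \<cdot>\<^sub>m P) (?F x))"
      unfolding map_degree_def field_degree_def
    proof (simp add: n, rule Brouwer_degree2_eq)
      fix x assume "x \<in> topspace (nsphere m)"
      let ?y = "lcp_map (Suc m) M (Matrix.vec (Suc m) x)"
      have vF: "Matrix.vec n (?F x) = Matrix.vec n x - A *\<^sub>v map_vec abs (Matrix.vec n x)"
        using A by (intro eq_vecI) (auto simp: pencil_field_def abs_field_eq_mult_vec[OF A])
      have yi: "?y $ i = mat_field ((1/2) \<cdot>\<^sub>m P) (?F x) i" if "i \<le> m" for i
        using that lcp[of "Matrix.vec n x"] mat_field_eq_mult_vec[OF hP(1), of i "?F x"]
        by (simp add: n[symmetric] vF) (simp add: n)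
      have dy: "dim_vec ?y = Suc m" using P lcp[of "Matrix.vec n x"] by (simp add: n[symmetric])
      show "normalized_sphere_map (Suc m) (lcp_map (Suc m) M) x = radial m (mat_field ((1/2) \<cdot>\<^sub>m P) (?F x))"
        using dy yi
        by (auto simp: normalized_sphere_map_def radial_def Let_def l2_norm_vec_def scalar_prod_self_eq
            lessThan_Suc_atMost less_Suc_eq_le fun_eq_iff)
    qed
    also have "\<dots> = field_degree m (mat_field ((1/2) \<cdot>\<^sub>m P)) * field_degree m ?F"
      using hP F(1) n by (intro field_degree_mat_compose) auto
    finally have "real_of_int (map_degree n (lcp_map n M)) =
        sgn (Determinant.det P) * (1 - (\<Sum>(l, S, v) \<in> {(l, S, v). eig_trio n A l S v \<and> l > 1}.
             sgn (poly (pderiv (char_poly (A * S))) l)))"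
      using F(2) hP n field_degree_mat_field[of "(1/2) \<cdot>\<^sub>m P" m] by simp
    also have "\<dots> = sgn (Determinant.det P) - (\<Sum>(l, S, v) \<in> {(l, S, v). eig_trio n A l S v \<and> l > 1}.
             sgn (Determinant.det P) * sgn (poly (pderiv (char_poly (A * S))) l))"
      by (simp add: right_diff_distrib sum_distrib_left case_prod_unfold)
    also have "(\<Sum>(l, S, v) \<in> {(l, S, v). eig_trio n A l S v \<and> l > 1}.
             sgn (Determinant.det P) * sgn (poly (pderiv (char_poly (A * S))) l))
        = (\<Sum>(l, S, v) \<in> {(l, S, v). (l, S, v) \<in> lcp_aligned_trios n M \<and> l > 1}.
         sgn (poly (pderiv (gen_char_poly P (N * S))) l))"
    proof (rule sum.cong)
      fix i assume "i \<in> {(l, S, v). (l, S, v) \<in> lcp_aligned_trios n M \<and> l > 1}"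
      then obtain l S v where i: "i = (l, S, v)" "eig_trio n A l S v" by (auto simp: trio)
      then have S: "S \<in> carrier_mat n n" by (auto simp: eig_trio_def sign_mats_def)
      \<comment> \<open>This brings the pair of the theorem into the factored form whose generalized
        polynomial is \<open>det P\<close> times that of \<open>A * S\<close>.\<close>
      have "N * S = P * (A * S)" using P A S PA by (simp flip: assoc_mult_mat[of P n n A n S n])
      then have "gen_char_poly P (N * S) = Polynomial.smult (Determinant.det P) (char_poly (A * S))"
        using gen_char_poly_factor[OF P, of "A * S"] A S by simp
      then show "(case i of (l, S, v) \<Rightarrow> sgn (Determinant.det P) * sgn (poly (pderiv (char_poly (A * S))) l))
        = (case i of (l, S, v) \<Rightarrow> sgn (poly (pderiv (gen_char_poly P (N * S))) l))"
        by (simp add: i pderiv_smult sgn_mult)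
    qed (simp add: trio)
    finally show ?thesis .
  qed
  ultimately show ?thesis by (simp only: P_def N_def)
qed

end
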